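(* Let $p=p(n)\in[0,1]$ and $q=q(n)\in[0,1]$ satisfy $p=\omega(\log n/n)$ and $q=\Omega(1)$ as $n\to\infty$, let $\tilde p=p/(p+q)$, and for each $n$ let $\mathscr G=(G_t)_{t\in\mathbb{N}}\sim\mathcal{G}(n,p,q)$ be the edge-Markovian sequence with starting graph $G_0\sim\mathcal{G}(n,\tilde p)$. Then $t_{\mathrm{mix}}(\mathcal{G}(n,p,q))=O(\log n)$; that is, there exist $t(n)=O(\log n)$ and sequences $\epsilon_n\to0$, $\delta_n\to0$ such that $\mathbb{P}[\,t_{\mathrm{mix}}(\mathscr G;\epsilon_n)\le t(n)\,]\ge1-\delta_n$ for all sufficiently large $n$.
   Context: $\mathcal{G}(n,\tilde p)$ is the Erdős–Rényi random graph on $V=\{1,\dots,n\}$, each of the $\binom n2$ edges being present independently with probability $\tilde p$. Edge-Markovian model $\mathcal{G}(n,p,q)$: given a starting graph $G_0$ on $V$, it is the random sequence of graphs $G_t=(V,E_t)$ in which, independently over all pairs $\{u,v\}$ of distinct vertices, $\mathbb{P}[\{u,v\}\in E_{t+1}\mid G_t]$ equals $1-q$ if $\{u,v\}\in E_t$ and $p$ if $\{u,v\}\notin E_t$. Random walk: $P_t$ is the lazy random walk transition matrix on $G_t$: $P_t(u,u)=1/2$, $P_t(u,v)=1/(2\deg_t(u))$ if $\{u,v\}\in E_t$, and $P_t(u,v)=0$ otherwise, where $\deg_t(u)$ is the degree of $u$ in $G_t$; if $\deg_t(u)=0$ the walk stays at $u$, i.e. $P_t(u,u)=1$. For $x\in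 V$, $\mu_0^x$ is the point mass at $x$ and $\mu_t^x=\mu_0^xP_1P_2\cdots P_t$. $\pi_t(x)=\deg_t(x)/(2|E_t|)$; if $E_t=\emptyset$, $\pi_t$ is undefined and closeness to $\pi_t$ is regarded as failing. $\|f-g\|_{TV}=\frac12\sum_{x\in V}|f(x)-g(x)|$. Mixing time: for a graph sequence $\mathscr G$ on $n$ vertices and $\epsilon>0$, $$t_{\mathrm{mix}}(\mathscr G;\epsilon)=\min\{t\in\mathbb{N}:\ \|\mu_s^x-\pi_s\|_{TV}\le\epsilon\ \text{ for all } x\in V\text{ and all integers } t\le s\le t+\sqrt n\}.$$ Probabilities are over the random graph sequence. *)

theory Defs
  imports "HOL-Probability.Probability" "HOL-Library.Landau_Symbols"
begin

text \<open>Graphs on \<open>V = {1..n}\<close> are represented by their edge sets, i.e. by subsets of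
  \<open>vertex_pairs n\<close>.\<close>

definition vertex_pairs :: "nat \<Rightarrow> nat set set" where
  "vertex_pairs n = {{u, v} | u v. u \<in> {1..n} \<and> v \<in> {1..n} \<and> u \<noteq> v}"

definition independent_edges :: "nat \<Rightarrow> (nat set \<Rightarrow> real) \<Rightarrow> nat set set pmf" where
  "independent_edges n w =
     map_pmf (\<lambda>b. {e \<in> vertex_pairs n. b e})
       (Pi_pmf (vertex_pairs n) False (\<lambda>e. bernoulli_pmf (w e)))"

definition erdos_renyi :: "nat \<Rightarrow> real \<Rightarrow> nat set set pmf" where
  "erdos_renyi n r = independent_edges n (\<lambda>_. r)"

definition edge_markovian_step :: "nat \<Rightarrow> real \<Rightarrow> real \<Rightarrow> nat set set \<Rightarrow> nat set set pmf" where
  "edge_markovian_step n p q E = independent_edges n (\<lambda>e. if e \<in> E then 1 - q else p)"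

text \<open>The locale leaves the law of the starting graph \<open>G 0\<close> open. The graphs form a Markov chain,
  so the transition law is imposed conditionally on the whole past \<open>G 0, \<dots>, G t\<close>, for every
  past of positive probability.\<close>

locale edge_markovian = prob_space M for M :: "'w measure" +
  fixes n :: nat and p q :: real and G :: "nat \<Rightarrow> 'w \<Rightarrow> nat set set"
  assumes measurable_graph: "\<And>t. G t \<in> measurable M (count_space (Pow (vertex_pairs n)))"
    and transition: "\<And>t g h. \<P>(\<omega> in M. \<forall>s\<le>t. G s \<omega> = g s) > 0 \<Longrightarrow>
      \<P>(\<omega> in M. G (Suc t) \<omega> = h \<bar> \<forall>s\<le>t. G s \<omega> = g s) = pmf (edge_markovian_step n p q (g t)) h"

definition degree :: "nat \<Rightarrow> nat set set \<Rightarrow> nat \<Rightarrow> nat" where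
  "degree n E u = card {v \<in> {1..n}. {u, v} \<in> E}"

definition lazy_walk :: "nat \<Rightarrow> nat set set \<Rightarrow> nat \<Rightarrow> nat \<Rightarrow> real" where
  "lazy_walk n E u v =
     (if degree n E u = 0 then (if u = v then 1 else 0)
      else if u = v then 1 / 2
      else if {u, v} \<in> E then 1 / (2 * real (degree n E u))
      else 0)"

text \<open>\<open>walk_dist n E x t\<close> is the row vector \<open>\<mu>\<^sub>t = \<mu>\<^sub>0 P\<^sub>1 \<cdots> P\<^sub>t\<close>: the first step
  already uses the graph \<open>E 1\<close>.\<close>

primrec walk_dist :: "nat \<Rightarrow> (nat \<Rightarrow> nat set set) \<Rightarrow> nat \<Rightarrow> nat \<Rightarrow> nat \<Rightarrow> real" where
  "walk_dist n E x 0 = (\<lambda>y. if y = x then 1 else 0)"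
| "walk_dist n E x (Suc t) = (\<lambda>y. \<Sum>z\<in>{1..n}. walk_dist n E x t z * lazy_walk n (E (Suc t)) z y)"

definition degree_dist :: "nat \<Rightarrow> nat set set \<Rightarrow> nat \<Rightarrow> real" where
  "degree_dist n E x = real (degree n E x) / (2 * real (card E))"

definition tv_dist :: "nat \<Rightarrow> (nat \<Rightarrow> real) \<Rightarrow> (nat \<Rightarrow> real) \<Rightarrow> real" where
  "tv_dist n f g = (1 / 2) * (\<Sum>x\<in>{1..n}. \<bar>f x - g x\<bar>)"

text \<open>Without edges the distribution \<open>degree_dist\<close> is undefined in the mathematical sense,
  and closeness to it counts as failing.\<close>

definition mixed_at :: "nat \<Rightarrow> (nat \<Rightarrow> nat set set) \<Rightarrow> real \<Rightarrow> nat \<Rightarrow> bool" where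
  "mixed_at n E \<epsilon> s \<longleftrightarrow>
     E s \<noteq> {} \<and> (\<forall>x\<in>{1..n}. tv_dist n (walk_dist n E x s) (degree_dist n (E s)) \<le> \<epsilon>)"

text \<open>The infimum in \<open>enat\<close> is the minimum of a nonempty set of naturals and \<open>\<infinity>\<close>
  for the empty set.\<close>

definition t_mix :: "nat \<Rightarrow> (nat \<Rightarrow> nat set set) \<Rightarrow> real \<Rightarrow> enat" where
  "t_mix n E \<epsilon> =
     Inf (enat ` {t. \<forall>s. t \<le> s \<and> real s \<le> real t + sqrt (real n) \<longrightarrow> mixed_at n E \<epsilon> s})"

end

theory Submission
  imports Defs
begin

text \<open>Each pair is a two-state Markov chain with stationary probability
  \<open>r = p / (p + q)\<close> of being an edge, so an Erdos-Renyi start makes every single graph \<open>G\<^sub>t\<close> an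
  Erdos-Renyi graph with parameter \<open>r\<close> (\<open>stationary_law\<close>). Since \<open>p + q \<le> 2\<close>, the mean degree
  \<open>D = (n - 1) r\<close> still grows faster than \<open>log n\<close>. The graphs at different times are
  dependent, but a union bound over the times copes with that: the proof finds a property of one
  graph that fails with probability \<open>O(n\<^sup>-\<^sup>3)\<close>, applies the union bound to the \<open>O(log n) + \<surd>n\<close> graphs seen by the walk, and argues
  deterministically on the event that all of them have the property.

  The property, \<open>concentrated\<close>, says that all degrees are \<open>(1 \<plusminus> \<delta>) D\<close> and that every cut has at
  least half of its expected number of edges. Both parts are Chernoff bounds
  (\<open>prob_not_concentrated\<close>). For a cut around a set \<open>S\<close> of at most \<open>n / 2\<close> vertices the failure
  probability is \<open>exp(- \<Omega>(|S| n r))\<close>, which beats the number \<open>n\<^bsup>|S|\<^esup>\<close> of such sets exactly because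
  \<open>n r\<close> exceeds a large multiple of \<open>log n\<close>. For the degrees one may take \<open>\<delta>\<close> of order
  \<open>\<surd>(log n / D)\<close>, which tends to \<open>0\<close>.

  On the deterministic side, the cut condition yields a Poincare inequality by the argument behind
  Cheeger's inequality (\<open>cuts_imp_Poincare\<close>). Because the degrees are almost constant, one lazy step
  contracts the plain Euclidean norm of every vector of total mass \<open>0\<close> by a constant factor
  (\<open>step_contracts\<close>) and moves the uniform vector only by \<open>O(\<delta> / \<surd>n)\<close>. Measuring everything against
  the uniform distribution rather than against the changing \<open>\<pi>\<^sub>t\<close> lets the steps be chained: the
  distance of \<open>\<mu>\<^sub>t\<close> from uniform is at most \<open>\<lambda>\<^sup>t + O(\<delta> / \<surd>n)\<close> with a constant \<open>\<lambda> < 1\<close>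
  (\<open>walk_dist_near_uniform\<close>). Cauchy-Schwarz costs a factor \<open>\<surd>n\<close>, so after \<open>O(log n)\<close> steps the
  total variation distance is \<open>o(1)\<close> and stays so; and \<open>\<pi>\<^sub>t\<close> is itself within \<open>O(\<delta>)\<close> of uniform.\<close>

section \<open>From edge cuts to a Poincare inequality\<close>

text \<open>A discrete co-area formula: \<open>\<bar>g u - g v\<bar>\<close> is a nonnegative combination of the cut indicators of
  the level sets of \<open>g\<close>. The induction peels off the topmost level set. The weights may be negative,
  so one application compares two weighted sums.\<close>
lemma cut_inequality_imp_L1_inequality:
  fixes w :: "'a \<Rightarrow> 'a \<Rightarrow> real" and g :: "'a \<Rightarrow> real"
  assumes V: "finite V"
    and cuts: "\<And>S. S \<subseteq> V \<Longrightarrow>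
      0 \<le> (\<Sum>u\<in>V. \<Sum>v\<in>V. w u v * \<bar>indicator S u - indicator S v\<bar>)"
  shows "0 \<le> (\<Sum>u\<in>V. \<Sum>v\<in>V. w u v * \<bar>g u - g v\<bar>)"
proof (induction "card (g ` V)" arbitrary: g rule: less_induct)
  case less
  show ?case
  proof (cases "\<exists>c. \<forall>u\<in>V. g u = c")
    case True
    then show ?thesis by (auto intro!: sum_nonneg)
  next
    case False
    \<comment> \<open>Capping \<open>g\<close> at its second largest value \<open>m\<close> removes one value.\<close>
    define M where "M = Max (g ` V)"
    define m where "m = Max (g ` V - {M})"
    define S where "S = {u\<in>V. g u = M}"
    define g' where "g' = (\<lambda>u. min (g u) m)"
    have ne: "V \<noteq> {}" using False by auto
    have fin: "finite (g ` V)" using V by simp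
    have M: "M \<in> g ` V" unfolding M_def using fin ne by (intro Max_in) auto
    have leM: "g u \<le> M" if "u \<in> V" for u unfolding M_def using fin that by simp
    have ne': "g ` V - {M} \<noteq> {}" using False by (metis Diff_eq_empty_iff image_subset_iff singleton_iff)
    have m: "m \<in> g ` V - {M}" unfolding m_def using fin ne' by (intro Max_in) auto
    have le_m: "g u \<le> m" if "u \<in> V" "g u \<noteq> M" for u
      unfolding m_def using fin that by (intro Max_ge) auto
    have mM: "m < M" using m leM by force
    have "g' ` V \<subseteq> g ` V - {M}"
    proof
      fix y assume "y \<in> g' ` V"
      then obtain u where u: "u \<in> V" "y = min (g u) m" by (auto simp: g'_def)
      show "y \<in> g ` V - {M}"
        using u m mM by (cases "g u \<le> m") (auto simp: min_def)
    qed
    then have "card (g' ` V) \<le> card (g ` V - {M})" using fin by (intro card_mono) auto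
    also have "\<dots> < card (g ` V)" using fin M by (intro card_Diff1_less)
    finally have IH: "0 \<le> (\<Sum>u\<in>V. \<Sum>v\<in>V. w u v * \<bar>g' u - g' v\<bar>)" by (rule less)
    have split: "\<bar>g u - g v\<bar> = \<bar>g' u - g' v\<bar> + (M - m) * \<bar>indicator S u - indicator S v\<bar>"
      if "u \<in> V" "v \<in> V" for u v
      using that le_m[of u] le_m[of v] mM leM[of u] leM[of v]
      by (cases "g u = M"; cases "g v = M") (auto simp: g'_def S_def min_def)
    have "(\<Sum>u\<in>V. \<Sum>v\<in>V. w u v * \<bar>g u - g v\<bar>) =
      (\<Sum>u\<in>V. \<Sum>v\<in>V. w u v * \<bar>g' u - g' v\<bar>)
      + (M - m) * (\<Sum>u\<in>V. \<Sum>v\<in>V. w u v * \<bar>indicator S u - indicator S v\<bar>)"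
      unfolding sum_distrib_left sum.distrib[symmetric]
      by (intro sum.cong refl) (simp add: split algebra_simps)
    also have "\<dots> \<ge> 0" using IH cuts[of S] mM by (auto simp: S_def)
    finally show ?thesis .
  qed
qed

text \<open>The smallest value that at least half of the values do not exceed is a median.\<close>
lemma median_exists:
  fixes f :: "'a \<Rightarrow> real"
  assumes V: "finite V"
  shows "\<exists>m. card V \<le> 2 * card {v\<in>V. f v \<le> m} \<and> card V \<le> 2 * card {v\<in>V. m \<le> f v}"
proof (cases "V = {}")
  case False
  define X where "X = {x \<in> f ` V. card V \<le> 2 * card {v\<in>V. f v \<le> x}}"
  have "Max (f ` V) \<in> f ` V" using False V by (intro Max_in) auto
  moreover have "{v\<in>V. f v \<le> Max (f ` V)} = V" using V by auto
  ultimately have "Max (f ` V) \<in> X" by (auto simp: X_def)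
  then have ne: "X \<noteq> {}" by auto
  have fin: "finite X" using V by (auto simp: X_def)
  define m where "m = Min X"
  have mX: "m \<in> X" unfolding m_def using fin ne by (rule Min_in)
  define L where "L = {v\<in>V. f v < m}"
  have "2 * card L \<le> card V"
  proof (cases "L = {}")
    case False
    have finL: "finite L" using V by (auto simp: L_def)
    define y where "y = Max (f ` L)"
    have y: "y \<in> f ` L" unfolding y_def using finL False by (intro Max_in) auto
    then have "y < m" by (auto simp: L_def)
    then have "y \<notin> X" unfolding m_def using Min_le[OF fin, of y] by linarith
    then have "2 * card {v\<in>V. f v \<le> y} < card V" using y by (auto simp: X_def L_def)
    moreover have "L \<subseteq> {v\<in>V. f v \<le> y}" using finL by (auto simp: L_def y_def)
    then have "card L \<le> card {v\<in>V. f v \<le> y}" using V by (intro card_mono) auto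
    ultimately show ?thesis by simp
  qed auto
  moreover have "card V = card L + card {v\<in>V. m \<le> f v}"
  proof -
    have "V = L \<union> {v\<in>V. m \<le> f v}" by (auto simp: L_def)
    then have "card V = card (L \<union> {v\<in>V. m \<le> f v})" by simp
    also have "\<dots> = card L + card {v\<in>V. m \<le> f v}"
      using V by (intro card_Un_disjoint) (auto simp: L_def)
    finally show ?thesis .
  qed
  ultimately show ?thesis using mX by (intro exI[of _ m]) (auto simp: X_def)
qed auto

text \<open>The signed square \<open>x \<bar>x\<bar>\<close> keeps the median at \<open>0\<close>, which \<open>x\<^sup>2\<close> would not, and still satisfies
  the bound that feeds Cauchy-Schwarz.\<close>
lemma signed_square_diff_le:
  fixes x y :: real
  shows "\<bar>x * \<bar>x\<bar> - y * \<bar>y\<bar>\<bar> \<le> \<bar>x - y\<bar> * (\<bar>x\<bar> + \<bar>y\<bar>)"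
proof -
  have *: "x * x - y * y = (x - y) * (x + y)" by (simp add: algebra_simps)
  have **: "\<bar>x * x + y * y\<bar> \<le> \<bar>x - y\<bar> * \<bar>x - y\<bar>" if "x * y \<le> 0"
  proof -
    have "\<bar>x * x + y * y\<bar> = x * x + y * y" by simp
    also have "\<dots> \<le> (x - y) * (x - y)" using that by (simp add: algebra_simps)
    finally show ?thesis by (simp add: abs_mult_self_eq)
  qed
  consider "x \<ge> 0" "y \<ge> 0" | "x \<le> 0" "y \<le> 0" | "x \<ge> 0" "y \<le> 0" | "x \<le> 0" "y \<ge> 0" by linarith
  then show ?thesis
  proof cases
    case 1
    then show ?thesis using * by (simp add: abs_mult)
  next
    case 2
    then have "\<bar>x * \<bar>x\<bar> - y * \<bar>y\<bar>\<bar> = \<bar>x * x - y * y\<bar>" by simp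
    also have "\<dots> = \<bar>x - y\<bar> * (\<bar>x\<bar> + \<bar>y\<bar>)" unfolding * using 2 by (simp add: abs_mult)
    finally show ?thesis by simp
  next
    case 3
    then have "x * y \<le> 0" by (simp add: mult_nonneg_nonpos)
    with ** 3 show ?thesis by (simp add: abs_mult)
  next
    case 4
    then have "x * y \<le> 0" by (simp add: mult_nonpos_nonneg)
    moreover have "\<bar>x * \<bar>x\<bar> - y * \<bar>y\<bar>\<bar> = \<bar>x * x + y * y\<bar>" using 4 by (simp add: abs_minus_commute)
    ultimately show ?thesis using ** 4 by simp
  qed
qed

lemma Cauchy_Schwarz_weighted:
  fixes a :: "'a \<Rightarrow> real"
  assumes a: "\<And>i. i \<in> I \<Longrightarrow> 0 \<le> a i"
  shows "(\<Sum>i\<in>I. a i * (f i * g i))\<^sup>2 \<le> (\<Sum>i\<in>I. a i * (f i)\<^sup>2) * (\<Sum>i\<in>I. a i * (g i)\<^sup>2)"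
proof -
  have "(\<Sum>i\<in>I. a i * (f i * g i)) = (\<Sum>i\<in>I. (sqrt (a i) * f i) * (sqrt (a i) * g i))"
  proof (intro sum.cong refl)
    fix i assume "i \<in> I"
    then have "sqrt (a i) * sqrt (a i) = a i" using a by simp
    then show "a i * (f i * g i) = (sqrt (a i) * f i) * (sqrt (a i) * g i)"
      by (metis mult.commute mult.left_commute)
  qed
  also have "\<dots>\<^sup>2 \<le> (\<Sum>i\<in>I. (sqrt (a i) * f i)\<^sup>2) * (\<Sum>i\<in>I. (sqrt (a i) * g i)\<^sup>2)"
    by (rule Cauchy_Schwarz_ineq_sum)
  also have "\<dots> = (\<Sum>i\<in>I. a i * (f i)\<^sup>2) * (\<Sum>i\<in>I. a i * (g i)\<^sup>2)"
    using a by (simp add: power_mult_distrib)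
  finally show ?thesis .
qed

text \<open>The argument behind Cheeger's inequality, with signed squares \<open>g = f \<bar>f\<bar>\<close>. By the
  cut condition, the \<open>L\<^sup>1\<close> variation of \<open>g\<close> along edges is at least \<open>\<kappa>\<close> times its variation over
  all pairs, and the latter is at least \<open>n / 2\<close> times the sum of \<open>f\<^sup>2\<close>, because at least half of the
  vertices lie on the other side of the median. From above, Cauchy-Schwarz bounds the square of the
  variation along edges by \<open>4 d\<close> times the sum of \<open>f\<^sup>2\<close> times the Dirichlet form of \<open>f\<close>.\<close>
lemma cuts_imp_Poincare_median:
  fixes a :: "'a \<Rightarrow> 'a \<Rightarrow> real" and f :: "'a \<Rightarrow> real"
  assumes V: "finite V"
    and sym: "\<And>u v. a u v = a v u" and nonneg: "\<And>u v. 0 \<le> a u v"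
    and kappa: "0 \<le> \<kappa>"
    and cuts: "\<And>S. S \<subseteq> V \<Longrightarrow>
      \<kappa> * real (card S) * real (card (V - S)) \<le> (\<Sum>u\<in>S. \<Sum>v\<in>V - S. a u v)"
    and deg: "\<And>u. u \<in> V \<Longrightarrow> (\<Sum>v\<in>V. a u v) \<le> d"
    and med: "card V \<le> 2 * card {v\<in>V. f v \<le> 0}" "card V \<le> 2 * card {v\<in>V. 0 \<le> f v}"
  shows "(\<kappa> * real (card V))\<^sup>2 * (\<Sum>u\<in>V. (f u)\<^sup>2)
    \<le> 16 * d * (\<Sum>u\<in>V. \<Sum>v\<in>V. a u v * (f u - f v)\<^sup>2)"
proof -
  define g where "g = (\<lambda>u. f u * \<bar>f u\<bar>)"
  define N where "N = (\<Sum>u\<in>V. (f u)\<^sup>2)"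
  define E where "E = (\<Sum>u\<in>V. \<Sum>v\<in>V. a u v * (f u - f v)\<^sup>2)"
  have cut_sum: "(\<Sum>u\<in>V. \<Sum>v\<in>V. b u v * \<bar>indicator S u - indicator S v\<bar>)
      = 2 * (\<Sum>u\<in>S. \<Sum>v\<in>V - S. b u v)"
    if S: "S \<subseteq> V" and b: "\<And>u v. b u v = b v u" for S and b :: "'a \<Rightarrow> 'a \<Rightarrow> real"
  proof -
    have sp: "(\<Sum>u\<in>V. h u) = (\<Sum>u\<in>S. h u) + (\<Sum>u\<in>V - S. h u)" for h :: "'a \<Rightarrow> real"
      using sum.subset_diff[OF S V, of h] by simp
    have "(\<Sum>u\<in>V. \<Sum>v\<in>V. b u v * \<bar>indicator S u - indicator S v\<bar>)
      = (\<Sum>u\<in>S. \<Sum>v\<in>V - S. b u v) + (\<Sum>u\<in>V - S. \<Sum>v\<in>S. b u v)"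
      unfolding sp by (intro arg_cong2[where f = "(+)"] sum.cong refl) 
         (auto simp: sum.neutral intro!: sum.cong)
    also have "(\<Sum>u\<in>V - S. \<Sum>v\<in>S. b u v) = (\<Sum>u\<in>S. \<Sum>v\<in>V - S. b u v)"
      by (subst sum.swap) (simp add: b)
    finally show ?thesis by simp
  qed
  have "0 \<le> (\<Sum>u\<in>V. \<Sum>v\<in>V. (a u v - \<kappa>) * \<bar>g u - g v\<bar>)"
  proof (rule cut_inequality_imp_L1_inequality[OF V])
    fix S assume S: "S \<subseteq> V"
    have "(\<Sum>u\<in>V. \<Sum>v\<in>V. (a u v - \<kappa>) * \<bar>indicator S u - indicator S v\<bar>)
       = 2 * (\<Sum>u\<in>S. \<Sum>v\<in>V - S. a u v - \<kappa>)"
      by (rule cut_sum[OF S]) (simp add: sym)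
    also have "\<dots> = 2 * ((\<Sum>u\<in>S. \<Sum>v\<in>V - S. a u v) - \<kappa> * real (card S) * real (card (V - S)))"
      by (simp add: sum_subtractf algebra_simps)
    also have "\<dots> \<ge> 0" using cuts[OF S] by simp
    finally show "0 \<le> (\<Sum>u\<in>V. \<Sum>v\<in>V. (a u v - \<kappa>) * \<bar>indicator S u - indicator S v :: real\<bar>)" .
  qed
  then have L1: "\<kappa> * (\<Sum>u\<in>V. \<Sum>v\<in>V. \<bar>g u - g v\<bar>) \<le> (\<Sum>u\<in>V. \<Sum>v\<in>V. a u v * \<bar>g u - g v\<bar>)"
    by (simp add: left_diff_distrib sum_subtractf sum_distrib_left)
  have far: "real (card V) * (f u)\<^sup>2 \<le> 2 * (\<Sum>v\<in>V. \<bar>g u - g v\<bar>)" for u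
  proof -
    \<comment> \<open>the vertices on the other side of the median from \<open>u\<close>\<close>
    define T where "T = (if 0 \<le> f u then {v\<in>V. f v \<le> 0} else {v\<in>V. 0 \<le> f v})"
    have T: "T \<subseteq> V" "card V \<le> 2 * card T" using med by (auto simp: T_def)
    have "(f u)\<^sup>2 \<le> \<bar>g u - g v\<bar>" if "v \<in> T" for v
    proof (cases "0 \<le> f u")
      case True
      with that have "f v \<le> 0" by (auto simp: T_def)
      then have "g v \<le> 0" by (simp add: g_def mult_nonpos_nonneg)
      then show ?thesis using True by (simp add: g_def power2_eq_square)
    next
      case False
      with that have "0 \<le> f v" by (auto simp: T_def)
      then have "0 \<le> g v" by (simp add: g_def)
      then show ?thesis using False by (simp add: g_def power2_eq_square)
    qed
    then have "real (card T) * (f u)\<^sup>2 \<le> (\<Sum>v\<in>T. \<bar>g u - g v\<bar>)"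
      using sum_mono[of T "\<lambda>_. (f u)\<^sup>2" "\<lambda>v. \<bar>g u - g v\<bar>"] by simp
    also have "\<dots> \<le> (\<Sum>v\<in>V. \<bar>g u - g v\<bar>)" using T V by (intro sum_mono2) auto
    finally have "2 * (real (card T) * (f u)\<^sup>2) \<le> 2 * (\<Sum>v\<in>V. \<bar>g u - g v\<bar>)" by simp
    moreover have "real (card V) * (f u)\<^sup>2 \<le> (2 * real (card T)) * (f u)\<^sup>2"
      using T(2) by (intro mult_right_mono) auto
    ultimately show ?thesis by simp
  qed
  have "real (card V) * N \<le> 2 * (\<Sum>u\<in>V. \<Sum>v\<in>V. \<bar>g u - g v\<bar>)"
    unfolding N_def sum_distrib_left by (intro sum_mono) (use far in \<open>simp add: sum_distrib_left\<close>)
  then have "\<kappa> * (real (card V) * N) \<le> \<kappa> * (2 * (\<Sum>u\<in>V. \<Sum>v\<in>V. \<bar>g u - g v\<bar>))"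
    using kappa by (rule mult_left_mono)
  also have "\<dots> \<le> 2 * (\<Sum>u\<in>V. \<Sum>v\<in>V. a u v * \<bar>g u - g v\<bar>)" using L1 by simp
  also have "(\<Sum>u\<in>V. \<Sum>v\<in>V. a u v * \<bar>g u - g v\<bar>)
     \<le> (\<Sum>u\<in>V. \<Sum>v\<in>V. a u v * (\<bar>f u - f v\<bar> * (\<bar>f u\<bar> + \<bar>f v\<bar>)))"
    unfolding g_def by (intro sum_mono mult_left_mono signed_square_diff_le nonneg)
  finally have lower: "\<kappa> * (real (card V) * N)
     \<le> 2 * (\<Sum>u\<in>V. \<Sum>v\<in>V. a u v * (\<bar>f u - f v\<bar> * (\<bar>f u\<bar> + \<bar>f v\<bar>)))" by simp
  have N0: "0 \<le> N" unfolding N_def by (intro sum_nonneg) auto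
  have E0: "0 \<le> E" unfolding E_def by (intro sum_nonneg mult_nonneg_nonneg nonneg) auto
  have CS: "(\<Sum>u\<in>V. \<Sum>v\<in>V. a u v * (\<bar>f u - f v\<bar> * (\<bar>f u\<bar> + \<bar>f v\<bar>)))\<^sup>2
     \<le> E * (\<Sum>u\<in>V. \<Sum>v\<in>V. a u v * (\<bar>f u\<bar> + \<bar>f v\<bar>)\<^sup>2)"
    using Cauchy_Schwarz_weighted[of "V \<times> V" "\<lambda>(u,v). a u v" "\<lambda>(u,v). \<bar>f u - f v\<bar>"
        "\<lambda>(u,v). \<bar>f u\<bar> + \<bar>f v\<bar>"]
    by (simp add: sum.cartesian_product split_def E_def nonneg)
  have deg_sum: "(\<Sum>u\<in>V. \<Sum>v\<in>V. a u v * (f u)\<^sup>2) \<le> d * N"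
  proof -
    have "(\<Sum>v\<in>V. a u v * (f u)\<^sup>2) \<le> d * (f u)\<^sup>2" if "u \<in> V" for u
      unfolding sum_distrib_right[symmetric] using deg[OF that] by (intro mult_right_mono) auto
    then show ?thesis unfolding N_def sum_distrib_left by (intro sum_mono)
  qed
  have deg_sum': "(\<Sum>u\<in>V. \<Sum>v\<in>V. a u v * (f v)\<^sup>2) \<le> d * N"
    using deg_sum by (subst sum.swap) (simp add: sym)
  have "(\<Sum>u\<in>V. \<Sum>v\<in>V. a u v * (\<bar>f u\<bar> + \<bar>f v\<bar>)\<^sup>2)
     \<le> (\<Sum>u\<in>V. \<Sum>v\<in>V. 2 * (a u v * (f u)\<^sup>2) + 2 * (a u v * (f v)\<^sup>2))"
  proof (intro sum_mono)
    fix u v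
    have "(\<bar>f u\<bar> + \<bar>f v\<bar>)\<^sup>2 \<le> 2 * (f u)\<^sup>2 + 2 * (f v)\<^sup>2"
      using sum_squares_bound[of "\<bar>f u\<bar>" "\<bar>f v\<bar>"] by (simp add: power2_sum)
    then have "a u v * (\<bar>f u\<bar> + \<bar>f v\<bar>)\<^sup>2 \<le> a u v * (2 * (f u)\<^sup>2 + 2 * (f v)\<^sup>2)"
      by (intro mult_left_mono nonneg)
    then show "a u v * (\<bar>f u\<bar> + \<bar>f v\<bar>)\<^sup>2 \<le> 2 * (a u v * (f u)\<^sup>2) + 2 * (a u v * (f v)\<^sup>2)"
      by (simp add: algebra_simps)
  qed
  also have "\<dots> \<le> 4 * (d * N)"
    using deg_sum deg_sum' by (simp add: sum.distrib sum_distrib_left[symmetric])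
  finally have upper: "(\<Sum>u\<in>V. \<Sum>v\<in>V. a u v * (\<bar>f u\<bar> + \<bar>f v\<bar>)\<^sup>2) \<le> 4 * (d * N)" .
  have "(\<kappa> * (real (card V) * N))\<^sup>2
     \<le> (2 * (\<Sum>u\<in>V. \<Sum>v\<in>V. a u v * (\<bar>f u - f v\<bar> * (\<bar>f u\<bar> + \<bar>f v\<bar>))))\<^sup>2"
    using lower kappa N0 by (intro power_mono) auto
  also have "\<dots> = 4 * (\<Sum>u\<in>V. \<Sum>v\<in>V. a u v * (\<bar>f u - f v\<bar> * (\<bar>f u\<bar> + \<bar>f v\<bar>)))\<^sup>2"
    by (simp add: power_mult_distrib)
  also have "\<dots> \<le> 4 * (E * (4 * (d * N)))"
    using CS mult_left_mono[OF upper E0] by linarith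
  finally have "N * ((\<kappa> * real (card V))\<^sup>2 * N) \<le> N * (16 * d * E)"
    by (simp add: power2_eq_square algebra_simps)
  then show ?thesis
  proof (cases "N = 0")
    case True
    have "0 \<le> d * E"
    proof (cases "V = {}")
      case False
      then obtain u where "u \<in> V" by auto
      then have "0 \<le> d" using deg[of u] sum_nonneg[of V "a u"] nonneg by force
      then show ?thesis using E0 by simp
    qed (simp add: E_def)
    then show ?thesis using True by (simp add: N_def E_def)
  next
    case False
    then show ?thesis
      using \<open>N * _ \<le> N * _\<close> N0 by (simp add: N_def E_def)
  qed
qed

text \<open>Subtracting the median leaves the Dirichlet form unchanged and can only increase the sum of
  squares of a function with mean \<open>0\<close>.\<close>
lemma cuts_imp_Poincare:
  fixes a :: "'a \<Rightarrow> 'a \<Rightarrow> real" and f :: "'a \<Rightarrow> real"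
  assumes V: "finite V"
    and sym: "\<And>u v. a u v = a v u" and nonneg: "\<And>u v. 0 \<le> a u v"
    and kappa: "0 \<le> \<kappa>"
    and cuts: "\<And>S. S \<subseteq> V \<Longrightarrow>
      \<kappa> * real (card S) * real (card (V - S)) \<le> (\<Sum>u\<in>S. \<Sum>v\<in>V - S. a u v)"
    and deg: "\<And>u. u \<in> V \<Longrightarrow> (\<Sum>v\<in>V. a u v) \<le> d"
    and mean: "(\<Sum>u\<in>V. f u) = 0"
  shows "(\<kappa> * real (card V))\<^sup>2 * (\<Sum>u\<in>V. (f u)\<^sup>2)
    \<le> 16 * d * (\<Sum>u\<in>V. \<Sum>v\<in>V. a u v * (f u - f v)\<^sup>2)"
proof -
  obtain m where m: "card V \<le> 2 * card {v\<in>V. f v \<le> m}" "card V \<le> 2 * card {v\<in>V. m \<le> f v}"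
    using median_exists[OF V] by blast
  \<comment> \<open>The cross term vanishes because \<open>f\<close> has mean \<open>0\<close>.\<close>
  have "(\<Sum>u\<in>V. (f u - m)\<^sup>2) = (\<Sum>u\<in>V. (f u)\<^sup>2) + real (card V) * m\<^sup>2"
    using mean by (simp add: power2_diff sum.distrib sum_subtractf sum_distrib_right[symmetric]
        sum_distrib_left[symmetric])
  then have "(\<kappa> * real (card V))\<^sup>2 * (\<Sum>u\<in>V. (f u)\<^sup>2) \<le> (\<kappa> * real (card V))\<^sup>2 * (\<Sum>u\<in>V. (f u - m)\<^sup>2)"
    by (intro mult_left_mono) auto
  also have "\<dots> \<le> 16 * d * (\<Sum>u\<in>V. \<Sum>v\<in>V. a u v * ((f u - m) - (f v - m))\<^sup>2)"
    by (rule cuts_imp_Poincare_median[OF V sym nonneg kappa cuts deg]) (use m in auto)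
  finally show ?thesis by simp
qed

section \<open>Contraction of the walk on nearly regular expanders\<close>

text \<open>Schur's test: the operator norm of a symmetric nonnegative matrix is at most its largest row
  sum.\<close>
lemma weighted_sum_sq_le:
  fixes a :: "'a \<Rightarrow> 'a \<Rightarrow> real" and g :: "'a \<Rightarrow> real"
  assumes sym: "\<And>u v. a u v = a v u" and nonneg: "\<And>u v. 0 \<le> a u v"
    and deg: "\<And>u. u \<in> V \<Longrightarrow> (\<Sum>v\<in>V. a u v) \<le> d" and d: "0 \<le> d"
  shows "(\<Sum>y\<in>V. (\<Sum>z\<in>V. a z y * g z)\<^sup>2) \<le> d\<^sup>2 * (\<Sum>z\<in>V. (g z)\<^sup>2)"
proof -
  have nn: "0 \<le> (\<Sum>z\<in>V. a z y * (g z)\<^sup>2)" for y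
    by (intro sum_nonneg mult_nonneg_nonneg nonneg) auto
  have "(\<Sum>y\<in>V. (\<Sum>z\<in>V. a z y * g z)\<^sup>2) \<le> (\<Sum>y\<in>V. d * (\<Sum>z\<in>V. a z y * (g z)\<^sup>2))"
  proof (rule sum_mono)
    fix y assume y: "y \<in> V"
    have "(\<Sum>z\<in>V. a z y * g z)\<^sup>2 \<le> (\<Sum>z\<in>V. a z y * (g z)\<^sup>2) * (\<Sum>z\<in>V. a z y)"
      using Cauchy_Schwarz_weighted[of V "\<lambda>z. a z y" g "\<lambda>_. 1"] nonneg by simp
    also have "(\<Sum>z\<in>V. a z y) = (\<Sum>z\<in>V. a y z)" using sym by auto
    also have "(\<Sum>z\<in>V. a z y * (g z)\<^sup>2) * \<dots> \<le> (\<Sum>z\<in>V. a z y * (g z)\<^sup>2) * d"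
      by (intro mult_left_mono deg y nn)
    finally show "(\<Sum>z\<in>V. a z y * g z)\<^sup>2 \<le> d * (\<Sum>z\<in>V. a z y * (g z)\<^sup>2)"
      by (simp add: mult.commute)
  qed
  also have "\<dots> = d * (\<Sum>z\<in>V. (\<Sum>y\<in>V. a z y) * (g z)\<^sup>2)"
    unfolding sum_distrib_left[symmetric] sum_distrib_right by (subst sum.swap) simp
  also have "\<dots> \<le> d * (\<Sum>z\<in>V. d * (g z)\<^sup>2)"
    by (intro mult_left_mono sum_mono mult_right_mono deg d) auto
  also have "\<dots> = d\<^sup>2 * (\<Sum>z\<in>V. (g z)\<^sup>2)"
    by (simp add: sum_distrib_left power2_eq_square mult.assoc)
  finally show ?thesis .
qed

text \<open>A symmetric weight with row sums close to \<open>D\<close>, all of whose cuts carry at least \<open>\<kappa>\<close> times the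
  number of pairs across. The condition \<open>D \<le> 2 \<kappa> n\<close> makes \<open>\<kappa> n\<close> at least
  \<open>D / 2\<close>, which is what turns into a spectral gap of constant order. The constant \<open>1 / 10000\<close>
  only has to be small compared with that gap.\<close>
locale near_regular_expander =
  fixes V :: "'a set" and a :: "'a \<Rightarrow> 'a \<Rightarrow> real" and D \<delta> \<kappa> :: real
  assumes fin: "finite V" and nonempty: "V \<noteq> {}"
    and sym: "\<And>u v. a u v = a v u" and nonneg: "\<And>u v. 0 \<le> a u v"
    and D: "0 < D" and delta0: "0 \<le> \<delta>" and delta1: "\<delta> \<le> 1 / 10000"
    and degree: "\<And>u. u \<in> V \<Longrightarrow> \<bar>(\<Sum>v\<in>V. a u v) - D\<bar> \<le> \<delta> * D"
    and kappa: "D \<le> 2 * \<kappa> * real (card V)"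
    and cuts: "\<And>S. S \<subseteq> V \<Longrightarrow>
      \<kappa> * real (card S) * real (card (V - S)) \<le> (\<Sum>u\<in>S. \<Sum>v\<in>V - S. a u v)"
begin

definition deg :: "'a \<Rightarrow> real" where "deg u = (\<Sum>v\<in>V. a u v)"

text \<open>The walk multiplies row vectors, hence the degree of the source \<open>z\<close> in the denominator.\<close>
definition step :: "('a \<Rightarrow> real) \<Rightarrow> 'a \<Rightarrow> real" where
  "step \<mu> y = \<mu> y / 2 + (\<Sum>z\<in>V. \<mu> z * a z y / (2 * deg z))"

lemma deg_bounds:
  assumes "u \<in> V"
  shows "deg u \<le> (1 + \<delta>) * D" "(1 - \<delta>) * D \<le> deg u" "0 < deg u"
proof -
  show 1: "deg u \<le> (1 + \<delta>) * D" "(1 - \<delta>) * D \<le> deg u"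
    using degree[OF assms] by (auto simp: deg_def algebra_simps abs_le_iff)
  have "0 < (1 - \<delta>) * D" using D delta1 by simp
  then show "0 < deg u" using 1 by linarith
qed

lemma Poincare:
  assumes mean: "(\<Sum>u\<in>V. f u) = 0"
  shows "D / 128 * (\<Sum>u\<in>V. (f u)\<^sup>2) \<le> (\<Sum>u\<in>V. \<Sum>v\<in>V. a u v * (f u - f v)\<^sup>2)"
proof -
  have n: "real (card V) > 0" using fin nonempty by (simp add: card_gt_0_iff)
  have "0 < 2 * \<kappa> * real (card V)" using D kappa by linarith
  then have k0: "0 \<le> \<kappa>" using n by (simp add: zero_less_mult_iff)
  have le: "(\<Sum>v\<in>V. a u v) \<le> 2 * D" if "u \<in> V" for u
  proof -
    have "(1 + \<delta>) * D \<le> 2 * D" using D delta1 by (intro mult_right_mono) auto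
    then show ?thesis using deg_bounds(1)[OF that] by (simp add: deg_def)
  qed
  have "(D / 2)\<^sup>2 * (\<Sum>u\<in>V. (f u)\<^sup>2) \<le> (\<kappa> * real (card V))\<^sup>2 * (\<Sum>u\<in>V. (f u)\<^sup>2)"
    using kappa D by (intro mult_right_mono power_mono sum_nonneg) auto
  also have "\<dots> \<le> 16 * (2 * D) * (\<Sum>u\<in>V. \<Sum>v\<in>V. a u v * (f u - f v)\<^sup>2)"
    by (rule cuts_imp_Poincare[OF fin sym nonneg k0 cuts le mean])
  finally have "D * (D / 128 * (\<Sum>u\<in>V. (f u)\<^sup>2)) \<le> D * (\<Sum>u\<in>V. \<Sum>v\<in>V. a u v * (f u - f v)\<^sup>2)"
    by (simp add: power2_eq_square field_simps)
  then show ?thesis using D by simp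
qed

text \<open>With the true degrees replaced by \<open>D\<close> the step becomes the symmetric matrix \<open>(1 + A / D) / 2\<close>.
  Expanding the square, the cross term is the degree term minus the Dirichlet form, and the
  Poincare inequality makes it strictly smaller than the degree term; laziness is what
  leaves the square of \<open>A / D\<close> harmless, because its norm is at most \<open>1 + \<delta>\<close>.\<close>
lemma regularised_step_contracts:
  assumes mean: "(\<Sum>u\<in>V. \<nu> u) = 0"
  shows "L2_set (\<lambda>y. \<nu> y / 2 + (\<Sum>z\<in>V. a z y * \<nu> z) / (2 * D)) V \<le> (1 - 1 / 1100) * L2_set \<nu> V"
proof -
  define N where "N = (\<Sum>u\<in>V. (\<nu> u)\<^sup>2)"
  define w where "w = (\<lambda>y. \<Sum>z\<in>V. a z y * \<nu> z)"
  define B where "B = (\<Sum>y\<in>V. \<nu> y * w y)"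
  define W where "W = (\<Sum>y\<in>V. (w y)\<^sup>2)"
  define E where "E = (\<Sum>u\<in>V. \<Sum>v\<in>V. a u v * (\<nu> u - \<nu> v)\<^sup>2)"
  have N0: "0 \<le> N" unfolding N_def by (intro sum_nonneg) auto
  have E: "D / 128 * N \<le> E" unfolding N_def E_def by (rule Poincare[OF mean])
  have W: "W \<le> ((1 + \<delta>) * D)\<^sup>2 * N"
    unfolding W_def w_def N_def
    by (rule weighted_sum_sq_le) (use sym nonneg deg_bounds D delta0 in \<open>auto simp: deg_def\<close>)
  have E_eq: "E = 2 * (\<Sum>u\<in>V. deg u * (\<nu> u)\<^sup>2) - 2 * B"
  proof -
    have "E = (\<Sum>u\<in>V. \<Sum>v\<in>V. a u v * (\<nu> u)\<^sup>2) + (\<Sum>u\<in>V. \<Sum>v\<in>V. a u v * (\<nu> v)\<^sup>2)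
      - 2 * (\<Sum>u\<in>V. \<Sum>v\<in>V. \<nu> u * (a v u * \<nu> v))"
      unfolding E_def sum_distrib_left sum.distrib[symmetric] sum_subtractf[symmetric]
      by (intro sum.cong refl) (simp add: sym[of _ u for u] power2_diff algebra_simps sym)
    also have "(\<Sum>u\<in>V. \<Sum>v\<in>V. a u v * (\<nu> v)\<^sup>2) = (\<Sum>u\<in>V. \<Sum>v\<in>V. a u v * (\<nu> u)\<^sup>2)"
      by (subst sum.swap) (simp add: sym)
    also have "(\<Sum>u\<in>V. \<Sum>v\<in>V. a u v * (\<nu> u)\<^sup>2) = (\<Sum>u\<in>V. deg u * (\<nu> u)\<^sup>2)"
      by (simp add: deg_def sum_distrib_right)
    also have "(\<Sum>u\<in>V. \<Sum>v\<in>V. \<nu> u * (a v u * \<nu> v)) = B"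
      by (simp add: B_def w_def sum_distrib_left)
    finally show ?thesis by simp
  qed
  have "(\<Sum>u\<in>V. deg u * (\<nu> u)\<^sup>2) \<le> (1 + \<delta>) * D * N"
    unfolding N_def sum_distrib_left
    by (intro sum_mono mult_right_mono deg_bounds) auto
  with E E_eq have B: "B \<le> (1 + \<delta>) * D * N - D * N / 256" by simp
  have "(\<Sum>y\<in>V. (\<nu> y / 2 + w y / (2 * D))\<^sup>2) = (N + 2 * (B / D) + W / D\<^sup>2) / 4"
  proof -
    have "(\<nu> y / 2 + w y / (2 * D))\<^sup>2 = ((\<nu> y)\<^sup>2 + 2 * (\<nu> y * w y / D) + (w y)\<^sup>2 / D\<^sup>2) / 4" for y
      using D by (simp add: power2_eq_square field_simps)
    then have "(\<Sum>y\<in>V. (\<nu> y / 2 + w y / (2 * D))\<^sup>2)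
      = (\<Sum>y\<in>V. ((\<nu> y)\<^sup>2 + 2 * (\<nu> y * w y / D) + (w y)\<^sup>2 / D\<^sup>2) / 4)"
      by (intro sum.cong refl)
    then show ?thesis
      unfolding N_def B_def W_def
      by (simp only: sum.distrib sum_divide_distrib[symmetric] sum_distrib_left[symmetric])
  qed
  also have "B / D \<le> (1 + \<delta>) * N - N / 256"
    using B D by (simp add: field_simps)
  also have "W / D\<^sup>2 \<le> (1 + \<delta>)\<^sup>2 * N"
    using W D by (simp add: divide_le_eq power_mult_distrib mult_ac)
  also have "(N + 2 * ((1 + \<delta>) * N - N / 256) + (1 + \<delta>)\<^sup>2 * N) / 4
     = ((1 + \<delta> / 2)\<^sup>2 - 1 / 512) * N"
    by (simp add: power2_eq_square field_simps)
  \<comment> \<open>The gain \<open>1 / 512\<close> exceeds the loss of about \<open>\<delta>\<close>, and \<open>1 - 1 / 1100\<close> stays above the square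
    root of the resulting factor.\<close>
  also have "\<dots> \<le> (1 - 1 / 1100)\<^sup>2 * N"
  proof (intro mult_right_mono N0)
    have "(1 + \<delta> / 2)\<^sup>2 \<le> (1 + 1 / 20000 :: real)\<^sup>2"
      using delta0 delta1 by (intro power_mono) auto
    then show "(1 + \<delta> / 2)\<^sup>2 - 1 / 512 \<le> (1 - 1 / 1100)\<^sup>2"
      by (simp add: power2_eq_square field_simps)
  qed
  finally have "(\<Sum>y\<in>V. (\<nu> y / 2 + w y / (2 * D))\<^sup>2) \<le> (1 - 1 / 1100)\<^sup>2 * N" by simp
  then have "sqrt (\<Sum>y\<in>V. (\<nu> y / 2 + w y / (2 * D))\<^sup>2) \<le> sqrt ((1 - 1 / 1100)\<^sup>2 * N)"
    by (rule real_sqrt_le_mono)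
  also have "\<dots> = (1 - 1 / 1100) * sqrt N" by (simp add: real_sqrt_mult)
  finally show ?thesis by (simp add: L2_set_def N_def w_def)
qed

text \<open>The part of the step lost by replacing the true degrees with \<open>D\<close>.\<close>
lemma degree_fluctuation_small:
  shows "L2_set (\<lambda>y. \<Sum>z\<in>V. a z y * (\<nu> z * (1 / (2 * deg z) - 1 / (2 * D)))) V \<le> 2 * \<delta> * L2_set \<nu> V"
proof -
  define c where "c = (\<lambda>z. 1 / (2 * deg z) - 1 / (2 * D))"
  have c: "\<bar>c z\<bar> \<le> \<delta> / D" if z: "z \<in> V" for z
  proof -
    note b = deg_bounds[OF z]
    have half: "D / 2 \<le> deg z"
    proof -
      have "D / 2 \<le> (1 - \<delta>) * D" using D delta1 by (simp add: field_simps)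
      then show ?thesis using b by linarith
    qed
    have "c z = (D - deg z) / (2 * deg z * D)"
      using D b by (simp add: c_def field_simps)
    then have "\<bar>c z\<bar> = \<bar>deg z - D\<bar> / (2 * deg z * D)"
      using D b by (simp add: abs_mult abs_minus_commute)
    also have "\<dots> \<le> (\<delta> * D) / (D * D)"
      using degree[OF z] D half delta0
      by (intro frac_le mult_right_mono) (auto simp: deg_def)
    finally show ?thesis using D by simp
  qed
  have "(\<Sum>y\<in>V. (\<Sum>z\<in>V. a z y * (\<nu> z * c z))\<^sup>2) \<le> ((1 + \<delta>) * D)\<^sup>2 * (\<Sum>z\<in>V. (\<nu> z * c z)\<^sup>2)"
    by (rule weighted_sum_sq_le) (use sym nonneg deg_bounds D delta0 in \<open>auto simp: deg_def\<close>)
  also have "\<dots> \<le> ((1 + \<delta>) * D)\<^sup>2 * (\<Sum>z\<in>V. (\<delta> / D)\<^sup>2 * (\<nu> z)\<^sup>2)"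
  proof (intro mult_left_mono sum_mono)
    fix z assume "z \<in> V"
    then have "\<bar>c z\<bar>\<^sup>2 \<le> (\<delta> / D)\<^sup>2" using c by (intro power_mono) auto
    then have "(c z)\<^sup>2 * (\<nu> z)\<^sup>2 \<le> (\<delta> / D)\<^sup>2 * (\<nu> z)\<^sup>2" by (intro mult_right_mono) auto
    then show "(\<nu> z * c z)\<^sup>2 \<le> (\<delta> / D)\<^sup>2 * (\<nu> z)\<^sup>2" by (simp add: power_mult_distrib mult.commute)
  qed auto
  also have "\<dots> = ((1 + \<delta>) * \<delta>)\<^sup>2 * (\<Sum>z\<in>V. (\<nu> z)\<^sup>2)"
    unfolding sum_distrib_left[symmetric] using D
    by (simp add: power_mult_distrib power_divide)
  also have "\<dots> \<le> (2 * \<delta>)\<^sup>2 * (\<Sum>z\<in>V. (\<nu> z)\<^sup>2)"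
    using delta0 delta1 by (intro mult_right_mono power_mono sum_nonneg) auto
  finally have "sqrt (\<Sum>y\<in>V. (\<Sum>z\<in>V. a z y * (\<nu> z * c z))\<^sup>2) \<le> sqrt ((2 * \<delta>)\<^sup>2 * (\<Sum>z\<in>V. (\<nu> z)\<^sup>2))"
    by (rule real_sqrt_le_mono)
  also have "\<dots> = 2 * \<delta> * sqrt (\<Sum>z\<in>V. (\<nu> z)\<^sup>2)"
    using delta0 by (simp add: real_sqrt_mult)
  finally show ?thesis by (simp add: L2_set_def c_def)
qed

lemma step_contracts:
  assumes mean: "(\<Sum>u\<in>V. \<nu> u) = 0"
  shows "L2_set (step \<nu>) V \<le> (1 - 1 / 2000) * L2_set \<nu> V"
proof -
  have eq: "step \<nu> y = (\<nu> y / 2 + (\<Sum>z\<in>V. a z y * \<nu> z) / (2 * D))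
      + (\<Sum>z\<in>V. a z y * (\<nu> z * (1 / (2 * deg z) - 1 / (2 * D))))" for y
  proof -
    have "\<nu> z * a z y / (2 * deg z)
       = a z y * \<nu> z / (2 * D) + a z y * (\<nu> z * (1 / (2 * deg z) - 1 / (2 * D)))" for z
      by (simp add: algebra_simps)
    then show ?thesis by (simp add: step_def sum.distrib sum_divide_distrib)
  qed
  have "L2_set (step \<nu>) V \<le> L2_set (\<lambda>y. \<nu> y / 2 + (\<Sum>z\<in>V. a z y * \<nu> z) / (2 * D)) V
      + L2_set (\<lambda>y. \<Sum>z\<in>V. a z y * (\<nu> z * (1 / (2 * deg z) - 1 / (2 * D)))) V"
    unfolding eq by (rule L2_set_triangle_ineq)
  also have "\<dots> \<le> (1 - 1 / 1100) * L2_set \<nu> V + 2 * \<delta> * L2_set \<nu> V"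
    by (intro add_mono regularised_step_contracts[OF mean] degree_fluctuation_small)
  also have "\<dots> = (1 - 1 / 1100 + 2 * \<delta>) * L2_set \<nu> V" by (simp add: algebra_simps)
  also have "\<dots> \<le> (1 - 1 / 2000) * L2_set \<nu> V"
    using delta1 by (intro mult_right_mono) auto
  finally show ?thesis .
qed

text \<open>Constant vectors would be fixed by the step if all degrees were equal.\<close>
lemma step_const_close:
  assumes y: "y \<in> V"
  shows "\<bar>step (\<lambda>_. c) y - c\<bar> \<le> 2 * \<delta> * \<bar>c\<bar>"
proof -
  define s where "s = (\<Sum>z\<in>V. a z y / deg z)"
  have pos: "0 < (1 - \<delta>) * D" "0 < (1 + \<delta>) * D" using D delta0 delta1 by auto
  have degy: "deg y = (\<Sum>z\<in>V. a z y)" by (simp add: deg_def sym)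
  have "s \<le> (\<Sum>z\<in>V. a z y / ((1 - \<delta>) * D))" unfolding s_def
    by (intro sum_mono divide_left_mono nonneg deg_bounds mult_pos_pos[OF deg_bounds(3) pos(1)])
  also have "\<dots> = deg y / ((1 - \<delta>) * D)" by (simp add: degy sum_divide_distrib)
  also have "\<dots> \<le> ((1 + \<delta>) * D) / ((1 - \<delta>) * D)"
    using pos deg_bounds[OF y] by (intro divide_right_mono) auto
  also have "\<dots> \<le> 1 + 4 * \<delta>"
  proof -
    have "\<delta> * (4 * \<delta>) \<le> \<delta> * 2" using delta0 delta1 by (intro mult_left_mono) auto
    then have "1 + \<delta> \<le> (1 + 4 * \<delta>) * (1 - \<delta>)" by (simp add: algebra_simps)
    then show ?thesis using D delta1 by (simp add: divide_le_eq)
  qed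
  finally have up: "s \<le> 1 + 4 * \<delta>" .
  have "1 - 4 * \<delta> \<le> ((1 - \<delta>) * D) / ((1 + \<delta>) * D)"
  proof -
    have "(1 - 4 * \<delta>) * (1 + \<delta>) \<le> 1 - \<delta>" using delta0 by (simp add: algebra_simps)
    then show ?thesis using D delta0 by (simp add: le_divide_eq)
  qed
  also have "\<dots> \<le> deg y / ((1 + \<delta>) * D)"
    using pos deg_bounds[OF y] by (intro divide_right_mono) auto
  also have "\<dots> = (\<Sum>z\<in>V. a z y / ((1 + \<delta>) * D))" by (simp add: degy sum_divide_distrib)
  also have "\<dots> \<le> s" unfolding s_def
    by (intro sum_mono divide_left_mono nonneg deg_bounds mult_pos_pos[OF pos(2) deg_bounds(3)])
  finally have low: "1 - 4 * \<delta> \<le> s" .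
  have "step (\<lambda>_. c) y - c = c / 2 * (s - 1)"
    by (simp add: step_def s_def sum_distrib_left algebra_simps)
  then have "\<bar>step (\<lambda>_. c) y - c\<bar> = \<bar>c\<bar> / 2 * \<bar>s - 1\<bar>"
    by (simp only: abs_mult abs_divide abs_numeral)
  also have "\<dots> \<le> \<bar>c\<bar> / 2 * (4 * \<delta>)"
    using up low by (intro mult_left_mono) auto
  finally show ?thesis by simp
qed

lemma sum_step: "(\<Sum>y\<in>V. step \<mu> y) = (\<Sum>y\<in>V. \<mu> y)"
proof -
  have "(\<Sum>y\<in>V. step \<mu> y) = (\<Sum>y\<in>V. \<mu> y) / 2 + (\<Sum>z\<in>V. \<Sum>y\<in>V. \<mu> z * a z y / (2 * deg z))"
    unfolding step_def sum.distrib sum_divide_distrib by (subst (2) sum.swap) simp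
  also have "(\<Sum>z\<in>V. \<Sum>y\<in>V. \<mu> z * a z y / (2 * deg z)) = (\<Sum>z\<in>V. \<mu> z / 2)"
  proof (intro sum.cong refl)
    fix z assume z: "z \<in> V"
    have "(\<Sum>y\<in>V. \<mu> z * a z y / (2 * deg z)) = \<mu> z * deg z / (2 * deg z)"
      by (simp add: deg_def sum_distrib_left sum_divide_distrib)
    then show "(\<Sum>y\<in>V. \<mu> z * a z y / (2 * deg z)) = \<mu> z / 2" using deg_bounds[OF z] by simp
  qed
  finally show ?thesis by (simp add: sum_divide_distrib[symmetric])
qed

text \<open>Split \<open>\<mu>\<close> into the uniform vector, which the step almost fixes, and a remainder of total mass \<open>0\<close>,
  which it contracts.\<close>
lemma step_approaches_uniform:
  assumes mass: "(\<Sum>y\<in>V. \<mu> y) = 1"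
  defines "c \<equiv> 1 / real (card V)"
  shows "L2_set (\<lambda>y. step \<mu> y - c) V
    \<le> (1 - 1 / 2000) * L2_set (\<lambda>y. \<mu> y - c) V + 2 * \<delta> / sqrt (card V)"
proof -
  have n: "real (card V) > 0" using fin nonempty by (simp add: card_gt_0_iff)
  have split: "step \<mu> y - c = step (\<lambda>y. \<mu> y - c) y + (step (\<lambda>_. c) y - c)" for y
    by (simp add: step_def left_diff_distrib diff_divide_distrib sum_subtractf)
  have "L2_set (\<lambda>y. step \<mu> y - c) V
     \<le> L2_set (step (\<lambda>y. \<mu> y - c)) V + L2_set (\<lambda>y. step (\<lambda>_. c) y - c) V"
    unfolding split by (rule L2_set_triangle_ineq)
  also have "L2_set (step (\<lambda>y. \<mu> y - c)) V \<le> (1 - 1 / 2000) * L2_set (\<lambda>y. \<mu> y - c) V"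
    by (rule step_contracts) (use mass n in \<open>simp add: sum_subtractf c_def\<close>)
  also have "L2_set (\<lambda>y. step (\<lambda>_. c) y - c) V \<le> L2_set (\<lambda>_. 2 * \<delta> * c) V"
  proof -
    have "L2_set (\<lambda>y. step (\<lambda>_. c) y - c) V = L2_set (\<lambda>y. \<bar>step (\<lambda>_. c) y - c\<bar>) V"
      by (simp add: L2_set_def)
    also have "\<dots> \<le> L2_set (\<lambda>_. 2 * \<delta> * c) V"
      using step_const_close[of _ c] n by (intro L2_set_mono) (auto simp: c_def)
    finally show ?thesis .
  qed
  also have "L2_set (\<lambda>_. 2 * \<delta> * c) V = 2 * \<delta> / sqrt (card V)"
  proof -
    have "L2_set (\<lambda>_. 2 * \<delta> * c) V = sqrt (card V) * (2 * \<delta> * c)"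
      using delta0 n by (simp add: L2_set_constant c_def)
    also have "\<dots> = 2 * \<delta> / sqrt (card V)"
      using n by (simp add: c_def field_simps)
    finally show ?thesis .
  qed
  finally show ?thesis by simp
qed

end

section \<open>Concentrated graphs mix the walk\<close>

text \<open>Stars are the cuts around single vertices, so one tail bound for the number of edges in a
  given set of pairs serves for degrees and for cuts.\<close>
definition cut_pairs :: "nat \<Rightarrow> nat set \<Rightarrow> nat set set" where
  "cut_pairs n S = (\<lambda>(u, v). {u, v}) ` (S \<times> ({1..n} - S))"

lemma finite_vertex_pairs [simp]: "finite (vertex_pairs n)"
proof -
  have "vertex_pairs n \<subseteq> Pow {1..n}" by (auto simp: vertex_pairs_def)
  then show ?thesis by (rule finite_subset) simp
qed

lemma inj_on_cut: "inj_on (\<lambda>(u, v). {u, v}) (S \<times> (V - S))"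
  by (auto simp: inj_on_def doubleton_eq_iff)

lemma cut_pairs_subset: "S \<subseteq> {1..n} \<Longrightarrow> cut_pairs n S \<subseteq> vertex_pairs n"
  by (fastforce simp: cut_pairs_def vertex_pairs_def)

lemma card_cut_pairs: "card (cut_pairs n S) = card S * card ({1..n} - S)"
  unfolding cut_pairs_def by (subst card_image[OF inj_on_cut]) (simp add: card_cartesian_product)

lemma card_Int_cut_pairs:
  assumes "S \<subseteq> {1..n}"
  shows "real (card (E \<inter> cut_pairs n S)) = (\<Sum>u\<in>S. \<Sum>v\<in>{1..n} - S. of_bool ({u, v} \<in> E))"
proof -
  have fin: "finite S" using assms finite_subset by blast
  have "(\<Sum>u\<in>S. \<Sum>v\<in>{1..n} - S. of_bool ({u, v} \<in> E) :: real)
    = (\<Sum>x\<in>S \<times> ({1..n} - S). of_bool ((\<lambda>(u, v). {u, v}) x \<in> E))"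
    by (simp add: sum.cartesian_product split_def del: sum_of_bool_eq)
  also have "\<dots> = (\<Sum>e\<in>cut_pairs n S. of_bool (e \<in> E))"
    unfolding cut_pairs_def by (subst sum.reindex[OF inj_on_cut]) simp
  also have "\<dots> = real (card (E \<inter> cut_pairs n S))"
    using fin by (simp add: cut_pairs_def of_bool_def sum.If_cases Int_commute)
  finally show ?thesis by simp
qed

lemma degree_eq_sum: "real (degree n E u) = (\<Sum>v\<in>{1..n}. of_bool ({u, v} \<in> E))"
  unfolding degree_def by (simp add: of_bool_def sum.If_cases Int_def)

lemma singleton_notin_vertex_pairs: "{u} \<notin> vertex_pairs n"
  by (auto simp: vertex_pairs_def doubleton_eq_iff singleton_insert_inj_eq')

lemma degree_eq_card_Int_cut_pairs:
  assumes "E \<subseteq> vertex_pairs n" "u \<in> {1..n}"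
  shows "degree n E u = card (E \<inter> cut_pairs n {u})"
proof -
  have "{u} \<notin> E" using assms singleton_notin_vertex_pairs by auto
  then have "real (degree n E u) = real (card (E \<inter> cut_pairs n {u}))"
    using assms(2) by (subst card_Int_cut_pairs) (auto simp: degree_eq_sum sum_diff1 simp del: sum_of_bool_eq)
  then show ?thesis by linarith
qed

lemma handshake:
  assumes "E \<subseteq> vertex_pairs n"
  shows "(\<Sum>u\<in>{1..n}. degree n E u) = 2 * card E"
proof -
  have finE: "finite E" using assms finite_vertex_pairs finite_subset by blast
  have "degree n E u = card {e\<in>E. u \<in> e}" if u: "u \<in> {1..n}" for u
  proof -
    have "bij_betw (\<lambda>v. {u, v}) {v\<in>{1..n}. {u, v} \<in> E} {e\<in>E. u \<in> e}"
    proof (rule bij_betwI')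
      fix e assume e: "e \<in> {e\<in>E. u \<in> e}"
      then obtain v w where "e = {v, w}" "v \<in> {1..n}" "w \<in> {1..n}"
        using assms by (auto simp: vertex_pairs_def)
      with e show "\<exists>v\<in>{v\<in>{1..n}. {u, v} \<in> E}. e = {u, v}"
        by (auto simp: insert_commute)
    qed (auto simp: doubleton_eq_iff)
    then show ?thesis unfolding degree_def by (rule bij_betw_same_card)
  qed
  then have "(\<Sum>u\<in>{1..n}. degree n E u) = (\<Sum>u\<in>{1..n}. card {e\<in>E. u \<in> e})" by simp
  also have "\<dots> = 2 * card E"
  proof (rule sum_multicount[OF _ finE])
    show "\<forall>e\<in>E. card {u\<in>{1..n}. u \<in> e} = 2"
    proof
      fix e assume "e \<in> E"
      then obtain v w where e: "e = {v, w}" "v \<in> {1..n}" "w \<in> {1..n}" "v \<noteq> w"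
        using assms by (auto simp: vertex_pairs_def)
      then have "{u\<in>{1..n}. u \<in> e} = {v, w}" by auto
      then show "card {u\<in>{1..n}. u \<in> e} = 2" using e by simp
    qed
  qed simp
  finally show ?thesis .
qed

definition concentrated :: "nat \<Rightarrow> real \<Rightarrow> real \<Rightarrow> nat set set \<Rightarrow> bool" where
  "concentrated n r \<delta> E \<longleftrightarrow> E \<subseteq> vertex_pairs n
     \<and> (\<forall>u\<in>{1..n}. \<bar>real (degree n E u) - real (n - 1) * r\<bar> \<le> \<delta> * (real (n - 1) * r))
     \<and> (\<forall>S\<subseteq>{1..n}. r / 2 * real (card S) * real (card ({1..n} - S)) \<le> real (card (E \<inter> cut_pairs n S)))"

abbreviation adjacency :: "nat set set \<Rightarrow> nat \<Rightarrow> nat \<Rightarrow> real" where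
  "adjacency E u v \<equiv> of_bool ({u, v} \<in> E)"

context
  fixes n :: nat and r \<delta> :: real
  assumes n: "2 \<le> n" and r: "0 < r" and \<delta>: "0 \<le> \<delta>" "\<delta> \<le> 1 / 10000"
begin

lemma concentrated_imp_expander:
  assumes "concentrated n r \<delta> E"
  shows "near_regular_expander {1..n} (adjacency E) (real (n - 1) * r) \<delta> (r / 2)"
  using assms n r \<delta>
  by unfold_locales
     (auto simp: concentrated_def insert_commute degree_eq_sum card_Int_cut_pairs of_nat_diff)

lemma walk_dist_Suc_eq_step:
  assumes c: "concentrated n r \<delta> (E (Suc t))" and y: "y \<in> {1..n}"
  shows "walk_dist n E x (Suc t) y
    = near_regular_expander.step {1..n} (adjacency (E (Suc t))) (walk_dist n E x t) y"
proof -
  define H where "H = E (Suc t)"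
  define \<mu> where "\<mu> = walk_dist n E x t"
  interpret near_regular_expander "{1..n}" "adjacency H" "real (n - 1) * r" \<delta> "r / 2"
    using concentrated_imp_expander c by (simp add: H_def)
  have loops: "{u} \<notin> H" for u
    using c singleton_notin_vertex_pairs by (auto simp: concentrated_def H_def)
  have deg: "deg u = real (degree n H u)" for u by (simp only: deg_def degree_eq_sum)
  have "(\<Sum>z\<in>{1..n}. \<mu> z * lazy_walk n H z y)
    = (\<Sum>z\<in>{1..n}. (if z = y then \<mu> z / 2 else 0) + \<mu> z * adjacency H z y / (2 * deg z))"
  proof (intro sum.cong refl)
    fix z assume z: "z \<in> {1..n}"
    have "degree n H z \<noteq> 0" using deg_bounds(3)[OF z] unfolding deg by simp
    then show "\<mu> z * lazy_walk n H z y
      = (if z = y then \<mu> z / 2 else 0) + \<mu> z * adjacency H z y / (2 * deg z)"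
      unfolding deg using loops by (simp add: lazy_walk_def)
  qed
  also have "\<dots> = step \<mu> y"
    unfolding step_def using y by (simp add: sum.distrib)
  finally show ?thesis by (simp add: H_def \<mu>_def)
qed

text \<open>The additive error \<open>4000 \<delta> / \<surd>n\<close> is the fixed point of \<open>x \<mapsto> (1 - 1 / 2000) x + 2 \<delta> / \<surd>n\<close>.
  The masses are carried along in the induction because the contraction needs total mass \<open>0\<close>
  after subtracting the uniform vector.\<close>
lemma walk_dist_near_uniform:
  assumes c: "\<And>s. 1 \<le> s \<Longrightarrow> s \<le> t \<Longrightarrow> concentrated n r \<delta> (E s)" and x: "x \<in> {1..n}"
  shows "(\<Sum>y\<in>{1..n}. walk_dist n E x t y) = 1
    \<and> L2_set (\<lambda>y. walk_dist n E x t y - 1 / real n) {1..n}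
        \<le> (1 - 1 / 2000) ^ t + 4000 * \<delta> / sqrt n"
  using c
proof (induction t)
  case 0
  have "(\<Sum>y\<in>{1..n}. (walk_dist n E x 0 y - 1 / real n)\<^sup>2) = 1 - 1 / real n"
  proof -
    have "(\<Sum>y\<in>{1..n}. (walk_dist n E x 0 y - 1 / real n)\<^sup>2)
      = (\<Sum>y\<in>{1..n}. (if y = x then 1 - 2 / real n else 0) + (1 / real n)\<^sup>2)"
      by (intro sum.cong refl) (auto simp: power2_eq_square algebra_simps)
    also have "\<dots> = 1 - 1 / real n"
      using x n by (simp add: sum.distrib power2_eq_square)
    finally show ?thesis .
  qed
  then have "L2_set (\<lambda>y. walk_dist n E x 0 y - 1 / real n) {1..n} \<le> sqrt 1"
    unfolding L2_set_def by (intro real_sqrt_le_mono) simp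
  moreover have "0 \<le> 4000 * \<delta> / sqrt n" using \<delta> by simp
  ultimately show ?case using x by simp
next
  case (Suc t)
  interpret near_regular_expander "{1..n}" "adjacency (E (Suc t))" "real (n - 1) * r" \<delta> "r / 2"
    by (rule concentrated_imp_expander, rule Suc.prems) auto
  have step: "walk_dist n E x (Suc t) y = step (walk_dist n E x t) y" if "y \<in> {1..n}" for y
    by (rule walk_dist_Suc_eq_step) (use Suc.prems that in auto)
  have IH: "(\<Sum>y\<in>{1..n}. walk_dist n E x t y) = 1"
    "L2_set (\<lambda>y. walk_dist n E x t y - 1 / real n) {1..n} \<le> (1 - 1 / 2000) ^ t + 4000 * \<delta> / sqrt n"
    using Suc by auto
  have "(\<Sum>y\<in>{1..n}. walk_dist n E x (Suc t) y) = (\<Sum>y\<in>{1..n}. step (walk_dist n E x t) y)"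
    by (intro sum.cong refl step)
  then have mass: "(\<Sum>y\<in>{1..n}. walk_dist n E x (Suc t) y) = 1" using IH(1) sum_step by simp
  have "L2_set (\<lambda>y. walk_dist n E x (Suc t) y - 1 / real n) {1..n}
      = L2_set (\<lambda>y. step (walk_dist n E x t) y - 1 / real n) {1..n}"
    by (intro L2_set_cong refl) (simp only: step)
  also have "\<dots> \<le> (1 - 1 / 2000) * L2_set (\<lambda>y. walk_dist n E x t y - 1 / real n) {1..n} + 2 * \<delta> / sqrt n"
    using step_approaches_uniform[OF IH(1)] by simp
  also have "\<dots> \<le> (1 - 1 / 2000) * ((1 - 1 / 2000) ^ t + 4000 * \<delta> / sqrt n) + 2 * \<delta> / sqrt n"
    by (intro add_right_mono mult_left_mono IH) simp
  also have "\<dots> = (1 - 1 / 2000) ^ Suc t + 4000 * \<delta> / sqrt n"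
    using n by (simp add: field_simps)
  finally show ?case using mass by simp
qed

lemma degree_dist_near_uniform:
  assumes c: "concentrated n r \<delta> E"
  shows "E \<noteq> {}" "(\<Sum>y\<in>{1..n}. \<bar>1 / real n - degree_dist n E y\<bar>) \<le> 4 * \<delta>"
proof -
  define D where "D = real (n - 1) * r"
  define S where "S = 2 * real (card E)"
  interpret near_regular_expander "{1..n}" "adjacency E" D \<delta> "r / 2"
    unfolding D_def by (rule concentrated_imp_expander[OF c])
  have deg: "deg u = real (degree n E u)" for u by (simp only: deg_def degree_eq_sum)
  have S_eq: "S = (\<Sum>u\<in>{1..n}. deg u)"
    unfolding deg S_def of_nat_sum[symmetric]
    using handshake[of E n] c by (simp add: concentrated_def)
  have pos: "0 < (1 - \<delta>) * D" using D delta1 by simp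
  have low: "real n * ((1 - \<delta>) * D) \<le> S" and up: "S \<le> real n * ((1 + \<delta>) * D)"
    using sum_bounded_below[of "{1..n}" "(1 - \<delta>) * D" deg] deg_bounds(2)
      sum_bounded_above[of "{1..n}" deg "(1 + \<delta>) * D"] deg_bounds(1) by (auto simp: S_eq)
  have Spos: "0 < S" using low pos n by (metis less_le_trans mult_pos_pos of_nat_0_less_iff pos2 order_less_le_trans)
  then show "E \<noteq> {}" by (auto simp: S_def)
  have "\<bar>1 / real n - degree_dist n E y\<bar> \<le> 4 * \<delta> / real n" if y: "y \<in> {1..n}" for y
  proof -
    have "\<bar>S - real n * deg y\<bar> \<le> 2 * \<delta> * (real n * D)"
    proof -
      have "real n * deg y \<le> real n * ((1 + \<delta>) * D)" "real n * ((1 - \<delta>) * D) \<le> real n * deg y"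
        using deg_bounds[OF y] by (auto intro!: mult_left_mono)
      with low up show ?thesis by (simp add: abs_le_iff algebra_simps)
    qed
    also have "\<dots> \<le> 4 * \<delta> * S"
    proof -
      have "real n * D \<le> 2 * (real n * ((1 - \<delta>) * D))"
      proof -
        have "D \<le> 2 * ((1 - \<delta>) * D)" using D delta1 by (simp add: field_simps)
        then have "real n * D \<le> real n * (2 * ((1 - \<delta>) * D))" by (rule mult_left_mono) simp
        then show ?thesis by simp
      qed
      then have "real n * D \<le> 2 * S" using low by linarith
      then have "2 * \<delta> * (real n * D) \<le> 2 * \<delta> * (2 * S)" using delta0 by (intro mult_left_mono) auto
      then show ?thesis by simp
    qed
    finally have *: "\<bar>S - real n * deg y\<bar> \<le> 4 * \<delta> * S" .
    have "1 / real n - degree_dist n E y = (S - real n * deg y) / (real n * S)"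
    proof -
      have "degree_dist n E y = deg y / S" by (simp only: degree_dist_def deg S_def)
      then show ?thesis using n Spos by (simp add: field_simps)
    qed
    then have "\<bar>1 / real n - degree_dist n E y\<bar> = \<bar>S - real n * deg y\<bar> / (real n * S)"
      using Spos by (simp add: abs_mult)
    also have "\<dots> \<le> 4 * \<delta> * S / (real n * S)"
      using * Spos by (intro divide_right_mono) auto
    finally show ?thesis using Spos by simp
  qed
  then have "(\<Sum>y\<in>{1..n}. \<bar>1 / real n - degree_dist n E y\<bar>) \<le> (\<Sum>y\<in>{1..n}. 4 * \<delta> / real n)"
    by (intro sum_mono)
  then show "(\<Sum>y\<in>{1..n}. \<bar>1 / real n - degree_dist n E y\<bar>) \<le> 4 * \<delta>" using n by simp
qed

lemma concentrated_imp_mixed_at: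
  assumes c: "\<And>s. 1 \<le> s \<Longrightarrow> s \<le> t \<Longrightarrow> concentrated n r \<delta> (E s)" and t: "1 \<le> t"
    and small: "(1 - 1 / 2000) ^ t * sqrt n + 2002 * \<delta> \<le> \<epsilon>"
  shows "mixed_at n E \<epsilon> t"
  unfolding mixed_at_def
proof (intro conjI ballI)
  have ct: "concentrated n r \<delta> (E t)" using c t by simp
  then show "E t \<noteq> {}" by (rule degree_dist_near_uniform)
  fix x assume x: "x \<in> {1..n}"
  define f where "f = (\<lambda>y. walk_dist n E x t y - 1 / real n)"
  have L2: "L2_set f {1..n} \<le> (1 - 1 / 2000) ^ t + 4000 * \<delta> / sqrt n"
    using walk_dist_near_uniform[OF c x] by (simp add: f_def)
  have "(\<Sum>y\<in>{1..n}. \<bar>walk_dist n E x t y - degree_dist n (E t) y\<bar>)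
     \<le> (\<Sum>y\<in>{1..n}. \<bar>f y\<bar> + \<bar>1 / real n - degree_dist n (E t) y\<bar>)"
    by (intro sum_mono) (simp add: f_def)
  also have "\<dots> = (\<Sum>y\<in>{1..n}. \<bar>f y\<bar>) + (\<Sum>y\<in>{1..n}. \<bar>1 / real n - degree_dist n (E t) y\<bar>)"
    by (rule sum.distrib)
  also have "(\<Sum>y\<in>{1..n}. \<bar>1 / real n - degree_dist n (E t) y\<bar>) \<le> 4 * \<delta>"
    by (rule degree_dist_near_uniform[OF ct])
  also have "(\<Sum>y\<in>{1..n}. \<bar>f y\<bar>) \<le> L2_set f {1..n} * sqrt n"
    using L2_set_mult_ineq[where f = f and g = "\<lambda>_. 1" and A = "{1..n}"]
    by (simp add: L2_set_constant)
  also have "\<dots> \<le> ((1 - 1 / 2000) ^ t + 4000 * \<delta> / sqrt n) * sqrt n"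
    by (intro mult_right_mono L2) simp
  also have "\<dots> = (1 - 1 / 2000) ^ t * sqrt n + 4000 * \<delta>"
    using n by (simp add: distrib_right)
  finally have "tv_dist n (walk_dist n E x t) (degree_dist n (E t))
     \<le> ((1 - 1 / 2000) ^ t * sqrt n + 4004 * \<delta>) / 2"
    by (simp add: tv_dist_def)
  also have "\<dots> \<le> (1 - 1 / 2000) ^ t * sqrt n + 2002 * \<delta>" by (simp add: add_divide_distrib)
  finally show "tv_dist n (walk_dist n E x t) (degree_dist n (E t)) \<le> \<epsilon>" using small by simp
qed

end

section \<open>Concentration of the random graph\<close>

lemma exp_le_quadratic:
  fixes l :: real
  assumes "\<bar>l\<bar> \<le> 1"
  shows "exp l \<le> 1 + l + l\<^sup>2"
proof (cases "0 \<le> l")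
  case True
  then show ?thesis using assms by (intro exp_bound) auto
next
  case False
  define x where "x = - l"
  have x: "0 < x" "x \<le> 1" using False assms by (auto simp: x_def)
  have "1 \<le> (1 - x + x\<^sup>2) * (1 + x)" using x by (simp add: algebra_simps power2_eq_square)
  also have "\<dots> \<le> (1 - x + x\<^sup>2) * exp x"
    using x by (intro mult_left_mono exp_ge_add_one_self) auto
  finally have "exp (- x) \<le> 1 - x + x\<^sup>2" by (simp add: exp_minus field_simps)
  then show ?thesis by (simp add: x_def)
qed

lemma set_pmf_independent_edges: "set_pmf (independent_edges n w) \<subseteq> Pow (vertex_pairs n)"
  by (auto simp: independent_edges_def)

lemma finite_set_pmf_erdos_renyi: "finite (set_pmf (erdos_renyi n r))"
  unfolding erdos_renyi_def by (rule finite_subset[OF set_pmf_independent_edges]) simp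

text \<open>The exponential of the number of edges in \<open>F\<close> is a product of independent factors, one for each
  pair.\<close>
lemma expectation_exp_card_erdos_renyi:
  assumes r: "0 \<le> r" "r \<le> 1" and F: "F \<subseteq> vertex_pairs n"
  shows "measure_pmf.expectation (erdos_renyi n r) (\<lambda>E. exp (l * real (card (E \<inter> F))))
    = (1 - r + r * exp l) ^ card F"
proof -
  have finF: "finite F" using F finite_vertex_pairs finite_subset by blast
  have "exp (l * real (card ({e \<in> vertex_pairs n. b e} \<inter> F)))
      = (\<Prod>e\<in>vertex_pairs n. if e \<in> F \<and> b e then exp l else 1)" for b
  proof -
    have "(\<Prod>e\<in>vertex_pairs n. if e \<in> F \<and> b e then exp l else 1)
       = (\<Prod>e\<in>{e \<in> vertex_pairs n. e \<in> F \<and> b e}. exp l)"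
      by (rule prod.inter_filter[symmetric]) simp
    also have "{e \<in> vertex_pairs n. e \<in> F \<and> b e} = {e \<in> vertex_pairs n. b e} \<inter> F" by auto
    finally show ?thesis by (simp add: exp_of_nat2_mult)
  qed
  then have "measure_pmf.expectation (erdos_renyi n r) (\<lambda>E. exp (l * real (card (E \<inter> F))))
    = measure_pmf.expectation (Pi_pmf (vertex_pairs n) False (\<lambda>e. bernoulli_pmf r))
       (\<lambda>b. \<Prod>e\<in>vertex_pairs n. if e \<in> F \<and> b e then exp l else 1)"
    by (simp add: erdos_renyi_def independent_edges_def)
  also have "\<dots> = (\<Prod>e\<in>vertex_pairs n. measure_pmf.expectation (bernoulli_pmf r)
       (\<lambda>v. if e \<in> F \<and> v then exp l else 1))"
    by (intro expectation_prod_Pi_pmf integrable_measure_pmf_finite) auto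
  also have "\<dots> = (\<Prod>e\<in>vertex_pairs n. if e \<in> F then 1 - r + r * exp l else 1)"
    using r by (intro prod.cong refl) auto
  also have "\<dots> = (\<Prod>e\<in>{e \<in> vertex_pairs n. e \<in> F}. 1 - r + r * exp l)"
    by (rule prod.inter_filter[symmetric]) simp
  also have "{e \<in> vertex_pairs n. e \<in> F} = F" using F by auto
  finally show ?thesis by simp
qed

text \<open>Markov's inequality for the exponential moment. Letting \<open>l\<close> have either sign covers the upper and
  the lower tail at once.\<close>
lemma exponential_tail_erdos_renyi:
  assumes r: "0 \<le> r" "r \<le> 1" and F: "F \<subseteq> vertex_pairs n" and l: "\<bar>l\<bar> \<le> 1"
  shows "measure_pmf.prob (erdos_renyi n r) {E. l * c \<le> l * real (card (E \<inter> F))}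
    \<le> exp (real (card F) * r * (l + l\<^sup>2) - l * c)"
proof -
  let ?P = "measure_pmf (erdos_renyi n r)"
  have int: "integrable ?P f" for f :: "nat set set \<Rightarrow> real"
    by (intro integrable_measure_pmf_finite finite_set_pmf_erdos_renyi)
  have "measure ?P {E. l * c \<le> l * real (card (E \<inter> F))}
      = measure_pmf.expectation (erdos_renyi n r) (indicator {E. l * c \<le> l * real (card (E \<inter> F))})"
    by simp
  also have "\<dots> \<le> measure_pmf.expectation (erdos_renyi n r)
      (\<lambda>E. exp (- (l * c)) * exp (l * real (card (E \<inter> F))))"
    by (intro integral_mono int) (auto simp: indicator_def mult_exp_exp)
  also have "\<dots> = exp (- (l * c)) * (1 + r * (exp l - 1)) ^ card F"
    using expectation_exp_card_erdos_renyi[OF r F, of l] by (simp add: algebra_simps)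
  also have "\<dots> \<le> exp (- (l * c)) * exp (r * (l + l\<^sup>2)) ^ card F"
  proof (intro mult_left_mono power_mono)
    have "r * (exp l - 1) \<le> r * (l + l\<^sup>2)"
      using exp_le_quadratic[OF l] r by (intro mult_left_mono) auto
    then show "1 + r * (exp l - 1) \<le> exp (r * (l + l\<^sup>2))"
      using exp_ge_add_one_self[of "r * (l + l\<^sup>2)"] by linarith
    have "0 \<le> 1 - r + r * exp l" using r by (intro add_nonneg_nonneg) auto
    then show "0 \<le> 1 + r * (exp l - 1)" by (simp add: algebra_simps)
  qed simp
  also have "\<dots> = exp (real (card F) * r * (l + l\<^sup>2) - l * c)"
    by (simp add: exp_of_nat_mult[symmetric] mult_exp_exp algebra_simps)
  finally show ?thesis .
qed

text \<open>The exponent \<open>l = \<plusminus>\<eta> / 2\<close> is the minimiser of the bound above.\<close>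
lemma Chernoff_erdos_renyi:
  assumes r: "0 \<le> r" "r \<le> 1" and F: "F \<subseteq> vertex_pairs n" and \<eta>: "0 < \<eta>" "\<eta> \<le> 1"
  shows "measure_pmf.prob (erdos_renyi n r) {E. (1 + \<eta>) * (real (card F) * r) \<le> real (card (E \<inter> F))}
      \<le> exp (- \<eta>\<^sup>2 * (real (card F) * r) / 4)"
    and "measure_pmf.prob (erdos_renyi n r) {E. real (card (E \<inter> F)) \<le> (1 - \<eta>) * (real (card F) * r)}
      \<le> exp (- \<eta>\<^sup>2 * (real (card F) * r) / 4)"
proof -
  define m where "m = real (card F) * r"
  have "measure_pmf.prob (erdos_renyi n r) {E. (\<eta> / 2) * ((1 + \<eta>) * m) \<le> (\<eta> / 2) * real (card (E \<inter> F))}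
     \<le> exp (m * (\<eta> / 2 + (\<eta> / 2)\<^sup>2) - (\<eta> / 2) * ((1 + \<eta>) * m))"
    unfolding m_def using \<eta> by (intro exponential_tail_erdos_renyi[OF r F]) auto
  also have "m * (\<eta> / 2 + (\<eta> / 2)\<^sup>2) - (\<eta> / 2) * ((1 + \<eta>) * m) = - \<eta>\<^sup>2 * m / 4"
    by (simp add: power2_eq_square field_simps)
  finally show "measure_pmf.prob (erdos_renyi n r) {E. (1 + \<eta>) * (real (card F) * r) \<le> real (card (E \<inter> F))}
      \<le> exp (- \<eta>\<^sup>2 * (real (card F) * r) / 4)"
    using \<eta> by (simp add: m_def)
  have "measure_pmf.prob (erdos_renyi n r) {E. (- \<eta> / 2) * ((1 - \<eta>) * m) \<le> (- \<eta> / 2) * real (card (E \<inter> F))}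
     \<le> exp (m * (- \<eta> / 2 + (- \<eta> / 2)\<^sup>2) - (- \<eta> / 2) * ((1 - \<eta>) * m))"
    unfolding m_def using \<eta> by (intro exponential_tail_erdos_renyi[OF r F]) auto
  also have "m * (- \<eta> / 2 + (- \<eta> / 2)\<^sup>2) - (- \<eta> / 2) * ((1 - \<eta>) * m) = - \<eta>\<^sup>2 * m / 4"
    by (simp add: power2_eq_square field_simps)
  also have "{E. (- \<eta> / 2) * ((1 - \<eta>) * m) \<le> (- \<eta> / 2) * real (card (E \<inter> F))}
    = {E. real (card (E \<inter> F)) \<le> (1 - \<eta>) * m}"
    using \<eta> by (simp add: mult_le_cancel_left)
  finally show "measure_pmf.prob (erdos_renyi n r) {E. real (card (E \<inter> F)) \<le> (1 - \<eta>) * (real (card F) * r)}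
      \<le> exp (- \<eta>\<^sup>2 * (real (card F) * r) / 4)"
    by (simp add: m_def)
qed

text \<open>The union bound over all vertex sets \<open>S\<close>, each with failure probability at most \<open>x\<^bsup>|S|\<^esup>\<close>, is the
  binomial theorem.\<close>
lemma sum_power_card_nonempty_subsets:
  assumes V: "finite V" and x: "0 \<le> x" "real (card V) * x \<le> 1"
  shows "(\<Sum>S | S \<subseteq> V \<and> S \<noteq> {}. x ^ card S) \<le> 2 * (real (card V) * x)"
proof -
  have "(\<Sum>S\<in>Pow V. x ^ card S) = (1 + x) ^ card V"
    using prod_add[OF V, of "\<lambda>_. x" "\<lambda>_. 1"] by (simp add: add.commute)
  moreover have "(\<Sum>S\<in>Pow V. x ^ card S) = 1 + (\<Sum>S\<in>Pow V - {{}}. x ^ card S)"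
    using V by (subst sum.remove[of _ "{}"]) auto
  moreover have "Pow V - {{}} = {S. S \<subseteq> V \<and> S \<noteq> {}}" by auto
  ultimately have "(\<Sum>S | S \<subseteq> V \<and> S \<noteq> {}. x ^ card S) = (1 + x) ^ card V - 1" by simp
  also have "(1 + x) ^ card V \<le> exp x ^ card V"
    using x exp_ge_add_one_self[of x] by (intro power_mono) auto
  also have "\<dots> = exp (real (card V) * x)" by (simp add: exp_of_nat_mult)
  also have "\<dots> \<le> 1 + real (card V) * x + (real (card V) * x)\<^sup>2"
    using x by (intro exp_le_quadratic) auto
  also have "(real (card V) * x)\<^sup>2 \<le> real (card V) * x"
    using x by (simp add: power2_eq_square mult_left_le)
  finally show ?thesis by linarith
qed

lemma cut_pairs_Diff: "S \<subseteq> {1..n} \<Longrightarrow> cut_pairs n ({1..n} - S) = cut_pairs n S"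
proof -
  assume S: "S \<subseteq> {1..n}"
  have "(\<lambda>(u, v). {u, v}) ` (A \<times> B) = (\<lambda>(u, v). {u, v}) ` (B \<times> A)" for A B :: "nat set"
    by (subst product_swap[symmetric]) (simp add: image_image split_def insert_commute)
  then show ?thesis using S by (simp add: cut_pairs_def double_diff)
qed

text \<open>A cut is also the cut around the complement, so only sets \<open>S\<close> with at most half of the
  vertices enter the union bound; for those, the cut has at least \<open>|S| n / 2\<close> pairs, and falling
  below half of its mean has probability at most \<open>exp(- |S| n r / 32)\<close>.\<close>
lemma prob_not_concentrated:
  assumes n: "2 \<le> n" and r: "0 \<le> r" "r \<le> 1" and \<delta>: "0 < \<delta>" "\<delta> \<le> 1"
    and small: "real n * exp (- (real n * r) / 32) \<le> 1"
  shows "measure_pmf.prob (erdos_renyi n r) {E. \<not> concentrated n r \<delta> E}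
    \<le> 2 * real n * exp (- \<delta>\<^sup>2 * (real (n - 1) * r) / 4) + 2 * real n * exp (- (real n * r) / 32)"
proof -
  define V where "V = {1..n}"
  define D where "D = real (n - 1) * r"
  define P where "P = measure_pmf.prob (erdos_renyi n r)"
  define small_sets where "small_sets = {S. S \<subseteq> V \<and> S \<noteq> {} \<and> 2 * card S \<le> n}"
  define X1 where "X1 = (\<lambda>u. {E :: nat set set. (1 + \<delta>) * D \<le> real (card (E \<inter> cut_pairs n {u}))})"
  define X2 where "X2 = (\<lambda>u. {E :: nat set set. real (card (E \<inter> cut_pairs n {u})) \<le> (1 - \<delta>) * D})"
  define Y where "Y = (\<lambda>S. {E :: nat set set. real (card (E \<inter> cut_pairs n S)) \<le> (1 - 1 / 2) * (real (card (cut_pairs n S)) * r)})"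
  define x where "x = exp (- (real n * r) / 32)"
  have card_star: "card (cut_pairs n {u}) = n - 1" if "u \<in> V" for u
    using that by (simp add: card_cut_pairs V_def)
  have finS: "finite small_sets" by (simp add: small_sets_def V_def)
  have "{E. \<not> concentrated n r \<delta> E} \<inter> set_pmf (erdos_renyi n r)
    \<subseteq> ((\<Union>u\<in>V. X1 u) \<union> (\<Union>u\<in>V. X2 u)) \<union> (\<Union>S\<in>small_sets. Y S)"
  proof (rule subsetI, rule ccontr)
    fix E assume E: "E \<in> {E. \<not> concentrated n r \<delta> E} \<inter> set_pmf (erdos_renyi n r)"
      and not: "E \<notin> ((\<Union>u\<in>V. X1 u) \<union> (\<Union>u\<in>V. X2 u)) \<union> (\<Union>S\<in>small_sets. Y S)"
    have EV: "E \<subseteq> vertex_pairs n"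
      using E set_pmf_independent_edges by (auto simp: erdos_renyi_def)
    have "\<bar>real (degree n E u) - D\<bar> \<le> \<delta> * D" if u: "u \<in> {1..n}" for u
    proof -
      have "E \<notin> X1 u" "E \<notin> X2 u" using not u by (auto simp: V_def)
      then show ?thesis
        using degree_eq_card_Int_cut_pairs[OF EV u]
        by (simp add: X1_def X2_def abs_le_iff distrib_right left_diff_distrib)
    qed
    moreover have "r / 2 * real (card S) * real (card ({1..n} - S)) \<le> real (card (E \<inter> cut_pairs n S))"
      if S: "S \<subseteq> {1..n}" for S
    proof -
      have sm: "r / 2 * real (card S) * real (card ({1..n} - S)) \<le> real (card (E \<inter> cut_pairs n S))"
        if "S \<in> small_sets" for S
      proof -
        have "E \<notin> Y S" using not that by auto
        then show ?thesis by (simp add: Y_def card_cut_pairs mult_ac)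
      qed
      show ?thesis
      proof (cases "S = {} \<or> {1..n} - S = {}")
        case False
        have "card ({1..n} - S) = n - card S"
          using S by (simp add: card_Diff_subset finite_subset)
        then have "S \<in> small_sets \<or> {1..n} - S \<in> small_sets"
          using False S by (auto simp: small_sets_def V_def)
        then show ?thesis
        proof
          assume "{1..n} - S \<in> small_sets"
          from sm[OF this] show ?thesis
            unfolding cut_pairs_Diff[OF S] using S by (simp add: double_diff mult_ac)
        qed (rule sm)
      next
        case True
        then have "real (card S) * real (card ({1..n} - S)) = 0"
          by (metis card.empty mult_zero_left mult_zero_right of_nat_0)
        then show ?thesis by (simp only: mult.assoc mult_zero_right of_nat_0_le_iff)
      qed
    qed
    ultimately have "concentrated n r \<delta> E" using EV by (simp add: concentrated_def D_def)
    with E show False by simp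
  qed
  then have "P {E. \<not> concentrated n r \<delta> E} \<le> P (((\<Union>u\<in>V. X1 u) \<union> (\<Union>u\<in>V. X2 u)) \<union> (\<Union>S\<in>small_sets. Y S))"
    unfolding P_def by (subst measure_Int_set_pmf[symmetric]) (rule measure_pmf.finite_measure_mono, auto)
  also have "\<dots> \<le> P ((\<Union>u\<in>V. X1 u) \<union> (\<Union>u\<in>V. X2 u)) + P (\<Union>S\<in>small_sets. Y S)"
    unfolding P_def by (rule measure_Un_le) auto
  also have "P ((\<Union>u\<in>V. X1 u) \<union> (\<Union>u\<in>V. X2 u)) \<le> P (\<Union>u\<in>V. X1 u) + P (\<Union>u\<in>V. X2 u)"
    unfolding P_def by (rule measure_Un_le) auto
  also have "P (\<Union>u\<in>V. X1 u) \<le> (\<Sum>u\<in>V. P (X1 u))"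
    unfolding P_def by (rule measure_UNION_le) (auto simp: V_def)
  also have "(\<Sum>u\<in>V. P (X1 u)) \<le> (\<Sum>u\<in>V. exp (- \<delta>\<^sup>2 * D / 4))"
  proof (rule sum_mono)
    fix u assume u: "u \<in> V"
    then have "cut_pairs n {u} \<subseteq> vertex_pairs n" by (intro cut_pairs_subset) (auto simp: V_def)
    from Chernoff_erdos_renyi(1)[OF r this \<delta>] show "P (X1 u) \<le> exp (- \<delta>\<^sup>2 * D / 4)"
      unfolding P_def X1_def D_def card_star[OF u] .
  qed
  also have "P (\<Union>u\<in>V. X2 u) \<le> (\<Sum>u\<in>V. P (X2 u))"
    unfolding P_def by (rule measure_UNION_le) (auto simp: V_def)
  also have "(\<Sum>u\<in>V. P (X2 u)) \<le> (\<Sum>u\<in>V. exp (- \<delta>\<^sup>2 * D / 4))"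
  proof (rule sum_mono)
    fix u assume u: "u \<in> V"
    then have "cut_pairs n {u} \<subseteq> vertex_pairs n" by (intro cut_pairs_subset) (auto simp: V_def)
    from Chernoff_erdos_renyi(2)[OF r this \<delta>] show "P (X2 u) \<le> exp (- \<delta>\<^sup>2 * D / 4)"
      unfolding P_def X2_def D_def card_star[OF u] .
  qed
  also have "P (\<Union>S\<in>small_sets. Y S) \<le> (\<Sum>S\<in>small_sets. P (Y S))"
    unfolding P_def by (rule measure_UNION_le) (use finS in auto)
  also have "(\<Sum>S\<in>small_sets. P (Y S)) \<le> (\<Sum>S\<in>small_sets. x ^ card S)"
  proof (rule sum_mono)
    fix S assume S: "S \<in> small_sets"
    then have SV: "S \<subseteq> {1..n}" and le: "2 * card S \<le> n" by (auto simp: small_sets_def V_def)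
    have card': "real (card ({1..n} - S)) \<ge> real n / 2"
      using SV le by (simp add: card_Diff_subset finite_subset of_nat_diff)
    have "P (Y S) \<le> exp (- (1 / 2)\<^sup>2 * (real (card (cut_pairs n S)) * r) / 4)"
      unfolding P_def Y_def by (rule Chernoff_erdos_renyi(2)[OF r cut_pairs_subset[OF SV]]) auto
    also have "\<dots> \<le> exp (real (card S) * (- (real n * r) / 32))"
    proof -
      have "real (card S) * r * (real n / 2) \<le> real (card S) * r * real (card ({1..n} - S))"
        using r card' by (intro mult_left_mono) auto
      then show ?thesis by (simp add: card_cut_pairs power2_eq_square mult_ac)
    qed
    also have "\<dots> = x ^ card S" unfolding x_def by (rule exp_of_nat_mult)
    finally show "P (Y S) \<le> x ^ card S" .
  qed
  also have "(\<Sum>S\<in>small_sets. x ^ card S) \<le> (\<Sum>S | S \<subseteq> V \<and> S \<noteq> {}. x ^ card S)"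
    by (intro sum_mono2) (auto simp: V_def small_sets_def x_def)
  also have "\<dots> \<le> 2 * (real (card V) * x)"
    using small by (intro sum_power_card_nonempty_subsets) (auto simp: V_def x_def)
  finally have bound: "P {E. \<not> concentrated n r \<delta> E}
    \<le> (\<Sum>u\<in>V. exp (- \<delta>\<^sup>2 * D / 4)) + (\<Sum>u\<in>V. exp (- \<delta>\<^sup>2 * D / 4)) + 2 * (real (card V) * x)"
    by simp
  have cV: "card V = n" by (simp add: V_def)
  show ?thesis using bound unfolding P_def D_def x_def sum_constant cV by linarith
qed

section \<open>The edge-Markovian process\<close>

lemma bernoulli_stationary:
  assumes p: "0 \<le> p" "p \<le> 1" and q: "0 \<le> q" "q \<le> 1"
  defines "r \<equiv> p / (p + q)"
  shows "0 \<le> r" "r \<le> 1"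
    "bind_pmf (bernoulli_pmf r) (\<lambda>b. bernoulli_pmf (if b then 1 - q else p)) = bernoulli_pmf r"
proof -
  show r: "0 \<le> r" "r \<le> 1" using p q by (auto simp: r_def divide_le_eq_1)
  have stat: "r * (1 - q) + (1 - r) * p = r"
  proof (cases "p + q = 0")
    case False
    then have "r * (p + q) = p" by (simp add: r_def)
    then show ?thesis by (simp add: algebra_simps)
  qed (use p q in \<open>auto simp: r_def add_nonneg_eq_0_iff\<close>)
  show "bind_pmf (bernoulli_pmf r) (\<lambda>b. bernoulli_pmf (if b then 1 - q else p)) = bernoulli_pmf r"
  proof (rule pmf_eqI)
    fix b
    show "pmf (bind_pmf (bernoulli_pmf r) (\<lambda>b. bernoulli_pmf (if b then 1 - q else p))) b
      = pmf (bernoulli_pmf r) b"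
      using r p q stat by (cases b) (auto simp: pmf_bind algebra_simps)
  qed
qed

text \<open>The pairs evolve independently, so stationarity of the graph reduces to that of one pair.\<close>
lemma erdos_renyi_stationary:
  assumes p: "0 \<le> p" "p \<le> 1" and q: "0 \<le> q" "q \<le> 1"
  shows "bind_pmf (erdos_renyi n (p / (p + q))) (edge_markovian_step n p q) = erdos_renyi n (p / (p + q))"
proof -
  define r where "r = p / (p + q)"
  define f where "f = (\<lambda>b. {e \<in> vertex_pairs n. b e})"
  define \<beta> where "\<beta> = Pi_pmf (vertex_pairs n) False (\<lambda>_. bernoulli_pmf r)"
  have step: "edge_markovian_step n p q (f b)
    = map_pmf f (Pi_pmf (vertex_pairs n) False (\<lambda>e. bernoulli_pmf (if b e then 1 - q else p)))" for b
    unfolding edge_markovian_step_def independent_edges_def f_def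
    by (intro map_pmf_cong Pi_pmf_cong refl) auto
  have "bind_pmf (erdos_renyi n r) (edge_markovian_step n p q)
    = bind_pmf \<beta> (\<lambda>b. edge_markovian_step n p q (f b))"
    by (simp add: erdos_renyi_def independent_edges_def bind_map_pmf f_def \<beta>_def)
  also have "\<dots> = map_pmf f (bind_pmf \<beta>
      (\<lambda>b. Pi_pmf (vertex_pairs n) False (\<lambda>e. bernoulli_pmf (if b e then 1 - q else p))))"
    by (simp add: step map_bind_pmf)
  also have "bind_pmf \<beta>
      (\<lambda>b. Pi_pmf (vertex_pairs n) False (\<lambda>e. bernoulli_pmf (if b e then 1 - q else p)))
    = Pi_pmf (vertex_pairs n) False
        (\<lambda>_. bind_pmf (bernoulli_pmf r) (\<lambda>b. bernoulli_pmf (if b then 1 - q else p)))"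
    unfolding \<beta>_def by (rule Pi_pmf_bind[symmetric]) simp
  also have "\<dots> = \<beta>"
    unfolding \<beta>_def r_def using bernoulli_stationary(3)[OF p q] by simp
  finally show ?thesis
    by (simp add: \<beta>_def f_def r_def erdos_renyi_def independent_edges_def)
qed

lemma (in finite_measure) measure_partition:
  assumes I: "finite I" and X: "\<And>\<omega>. \<omega> \<in> space M \<Longrightarrow> Q \<omega> \<Longrightarrow> X \<omega> \<in> I"
    and meas: "\<And>i. i \<in> I \<Longrightarrow> {\<omega> \<in> space M. X \<omega> = i \<and> Q \<omega>} \<in> sets M"
  shows "measure M {\<omega> \<in> space M. Q \<omega>} = (\<Sum>i\<in>I. measure M {\<omega> \<in> space M. X \<omega> = i \<and> Q \<omega>})"
proof -
  have "{\<omega> \<in> space M. Q \<omega>} = (\<Union>i\<in>I. {\<omega> \<in> space M. X \<omega> = i \<and> Q \<omega>})" using X by auto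
  then show ?thesis
    using I meas by (simp only:, intro finite_measure_finite_Union) (auto simp: disjoint_family_on_def)
qed

lemma t_mix_le_iff:
  "t_mix n E \<epsilon> \<le> enat T \<longleftrightarrow>
    (\<exists>t\<le>T. \<forall>s. t \<le> s \<and> real s \<le> real t + sqrt (real n) \<longrightarrow> mixed_at n E \<epsilon> s)"
proof -
  define A where "A = {t. \<forall>s. t \<le> s \<and> real s \<le> real t + sqrt (real n) \<longrightarrow> mixed_at n E \<epsilon> s}"
  have "Inf (enat ` A) \<le> enat T \<longleftrightarrow> (\<exists>t\<le>T. t \<in> A)"
  proof
    assume le: "Inf (enat ` A) \<le> enat T"
    then have ne: "enat ` A \<noteq> {}" by (auto simp: Inf_enat_def)
    then have "Inf (enat ` A) \<in> enat ` A"
      unfolding Inf_enat_def by (auto intro: LeastI)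
    with le show "\<exists>t\<le>T. t \<in> A" by auto
  qed (auto intro: Inf_lower2)
  then show ?thesis by (simp add: t_mix_def A_def)
qed

context edge_markovian
begin

lemma measurable_graph_UNIV [measurable]: "G t \<in> measurable M (count_space UNIV)"
  by (rule measurable_compose[OF measurable_graph, where g = "\<lambda>x. x"]) simp

lemma graph_event: "{\<omega> \<in> space M. R (G t \<omega>)} \<in> events"
  using measurable_compose[OF measurable_graph_UNIV, of R "count_space UNIV" t]
  by (simp add: pred_def)

lemma graph_in: "\<omega> \<in> space M \<Longrightarrow> G t \<omega> \<subseteq> vertex_pairs n"
  using measurable_space[OF measurable_graph, of \<omega> t] by auto

text \<open>The transition law is given conditionally on the whole past. Summing over the finitely many pasts
  whose last graph is \<open>e\<close> gives the transition law conditionally on the last graph only.\<close>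
lemma joint_law_step:
  "\<P>(\<omega> in M. G t \<omega> = e \<and> G (Suc t) \<omega> = h)
    = \<P>(\<omega> in M. G t \<omega> = e) * pmf (edge_markovian_step n p q e) h"
proof -
  define I where "I = (\<Pi>\<^sub>E s\<in>{..t}. Pow (vertex_pairs n))"
  define X where "X = (\<lambda>\<omega>. restrict (\<lambda>s. G s \<omega>) {..t})"
  have I: "finite I" unfolding I_def by (intro finite_PiE) auto
  have X_in: "X \<omega> \<in> I" if "\<omega> \<in> space M" for \<omega>
    using graph_in[OF that] by (auto simp: I_def X_def)
  have X_eq: "X \<omega> = g \<longleftrightarrow> (\<forall>s\<le>t. G s \<omega> = g s)" if "g \<in> I" for g \<omega>
    using that by (auto simp: I_def X_def fun_eq_iff PiE_def extensional_def)
  have past: "\<P>(\<omega> in M. X \<omega> = g \<and> G t \<omega> = e \<and> G (Suc t) \<omega> = h)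
     = \<P>(\<omega> in M. X \<omega> = g \<and> G t \<omega> = e) * pmf (edge_markovian_step n p q e) h" if g: "g \<in> I" for g
  proof (cases "g t = e")
    case False
    then have "{\<omega> \<in> space M. X \<omega> = g \<and> G t \<omega> = e \<and> G (Suc t) \<omega> = h} = {}"
      "{\<omega> \<in> space M. X \<omega> = g \<and> G t \<omega> = e} = {}" using X_eq[OF g] by auto
    then show ?thesis by (simp only: measure_empty mult_zero_left)
  next
    case True
    define A where "A = \<P>(\<omega> in M. \<forall>s\<le>t. G s \<omega> = g s)"
    define B where "B = \<P>(\<omega> in M. G (Suc t) \<omega> = h \<and> (\<forall>s\<le>t. G s \<omega> = g s))"
    have "{\<omega> \<in> space M. X \<omega> = g \<and> G t \<omega> = e} = {\<omega> \<in> space M. \<forall>s\<le>t. G s \<omega> = g s}"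
      "{\<omega> \<in> space M. X \<omega> = g \<and> G t \<omega> = e \<and> G (Suc t) \<omega> = h}
        = {\<omega> \<in> space M. G (Suc t) \<omega> = h \<and> (\<forall>s\<le>t. G s \<omega> = g s)}"
      using True X_eq[OF g] by auto
    moreover have "B = A * pmf (edge_markovian_step n p q e) h"
    proof (cases "A = 0")
      case A0: True
      have "B \<le> A" unfolding A_def B_def
        by (intro finite_measure_mono) auto
      then have "B = 0" using A0 by (simp add: B_def order_antisym)
      then show ?thesis using A0 by simp
    next
      case False
      then have "A > 0" by (simp add: A_def less_le)
      then have "B / A = pmf (edge_markovian_step n p q e) h"
        using transition[of t g h] True by (simp add: cond_prob_def A_def B_def)
      then show ?thesis using False by (simp add: field_simps)
    qed
    ultimately show ?thesis by (simp add: A_def B_def)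
  qed
  have X_sets: "{\<omega> \<in> space M. X \<omega> = g \<and> R \<omega>} \<in> events"
    if "g \<in> I" and [measurable]: "Measurable.pred M R" for g R
    unfolding X_eq[OF that(1)] by measurable
  have "\<P>(\<omega> in M. G t \<omega> = e \<and> G (Suc t) \<omega> = h)
      = (\<Sum>g\<in>I. \<P>(\<omega> in M. X \<omega> = g \<and> G t \<omega> = e \<and> G (Suc t) \<omega> = h))"
    by (rule measure_partition[OF I]) (auto intro!: X_in X_sets)
  also have "\<dots> = (\<Sum>g\<in>I. \<P>(\<omega> in M. X \<omega> = g \<and> G t \<omega> = e)) * pmf (edge_markovian_step n p q e) h"
    unfolding sum_distrib_right by (rule sum.cong[OF refl past])
  also have "(\<Sum>g\<in>I. \<P>(\<omega> in M. X \<omega> = g \<and> G t \<omega> = e)) = \<P>(\<omega> in M. G t \<omega> = e)"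
    by (rule measure_partition[OF I, symmetric]) (auto intro!: X_in X_sets)
  finally show ?thesis .
qed

lemma stationary_law:
  assumes pq: "0 \<le> p" "p \<le> 1" "0 \<le> q" "q \<le> 1"
    and start: "distr M (count_space UNIV) (G 0) = measure_pmf (erdos_renyi n (p / (p + q)))"
  shows "\<P>(\<omega> in M. G t \<omega> = h) = pmf (erdos_renyi n (p / (p + q))) h"
proof (induction t arbitrary: h)
  case 0
  have "pmf (erdos_renyi n (p / (p + q))) h = measure (distr M (count_space UNIV) (G 0)) {h}"
    by (simp add: start pmf.rep_eq)
  also have "\<dots> = \<P>(\<omega> in M. G 0 \<omega> = h)"
    by (subst measure_distr) (auto simp: vimage_def Int_def conj_commute)
  finally show ?case by simp
next
  case (Suc t)
  define ER where "ER = erdos_renyi n (p / (p + q))"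
  have ER_in: "set_pmf ER \<subseteq> Pow (vertex_pairs n)"
    unfolding ER_def erdos_renyi_def by (rule set_pmf_independent_edges)
  have "\<P>(\<omega> in M. G (Suc t) \<omega> = h)
    = (\<Sum>e\<in>Pow (vertex_pairs n). \<P>(\<omega> in M. G t \<omega> = e \<and> G (Suc t) \<omega> = h))"
    by (rule measure_partition) (use graph_in in auto)
  also have "\<dots> = (\<Sum>e\<in>Pow (vertex_pairs n). pmf (edge_markovian_step n p q e) h * pmf ER e)"
    by (simp add: joint_law_step Suc.IH ER_def mult.commute)
  also have "\<dots> = pmf (bind_pmf ER (edge_markovian_step n p q)) h"
    unfolding pmf_bind using ER_in
    by (intro integral_measure_pmf_real[symmetric]) auto
  also have "bind_pmf ER (edge_markovian_step n p q) = ER"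
    unfolding ER_def by (rule erdos_renyi_stationary[OF pq])
  finally show ?case by (simp add: ER_def)
qed

lemma prob_graph_in:
  assumes pq: "0 \<le> p" "p \<le> 1" "0 \<le> q" "q \<le> 1"
    and start: "distr M (count_space UNIV) (G 0) = measure_pmf (erdos_renyi n (p / (p + q)))"
  shows "\<P>(\<omega> in M. G t \<omega> \<in> B) = measure_pmf.prob (erdos_renyi n (p / (p + q))) B"
proof -
  define ER where "ER = erdos_renyi n (p / (p + q))"
  define B' where "B' = B \<inter> Pow (vertex_pairs n)"
  have fin: "finite B'" by (simp add: B'_def)
  have "\<P>(\<omega> in M. G t \<omega> \<in> B) = (\<Sum>h\<in>B'. \<P>(\<omega> in M. G t \<omega> = h \<and> G t \<omega> \<in> B))"
    by (rule measure_partition[OF fin])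
       (use graph_in graph_event[of "\<lambda>E. E = h \<and> E \<in> B" t for h] in \<open>auto simp: B'_def\<close>)
  also have "\<dots> = (\<Sum>h\<in>B'. \<P>(\<omega> in M. G t \<omega> = h))"
    by (intro sum.cong refl arg_cong[where f = prob]) (auto simp: B'_def)
  also have "\<dots> = (\<Sum>h\<in>B'. pmf ER h)"
    by (simp add: stationary_law[OF pq start] ER_def)
  also have "\<dots> = measure_pmf.prob ER B'"
    using fin by (simp add: measure_measure_pmf_finite)
  also have "\<dots> = measure_pmf.prob ER B"
  proof -
    have "set_pmf ER \<subseteq> Pow (vertex_pairs n)"
      unfolding ER_def erdos_renyi_def by (rule set_pmf_independent_edges)
    then have "B' \<inter> set_pmf ER = B \<inter> set_pmf ER" by (auto simp: B'_def)
    then show ?thesis by (metis measure_Int_set_pmf)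
  qed
  finally show ?thesis by (simp add: ER_def)
qed

lemma measurable_walk_dist [measurable]:
  "(\<lambda>\<omega>. walk_dist n (\<lambda>s. G s \<omega>) x t y) \<in> borel_measurable M"
proof (induction t arbitrary: y)
  case (Suc t)
  have [measurable]: "(\<lambda>\<omega>. lazy_walk n (G (Suc t) \<omega>) z y) \<in> borel_measurable M" for z
    by (rule measurable_compose[OF measurable_graph_UNIV]) simp
  show ?case using Suc by simp
qed simp

lemma measurable_mixed_at [measurable]: "Measurable.pred M (\<lambda>\<omega>. mixed_at n (\<lambda>s. G s \<omega>) \<epsilon> s)"
proof -
  have [measurable]: "(\<lambda>\<omega>. degree_dist n (G s \<omega>) y) \<in> borel_measurable M" for y
    by (rule measurable_compose[OF measurable_graph_UNIV]) simp
  have [measurable]: "Measurable.pred M (\<lambda>\<omega>. G s \<omega> \<noteq> {})"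
    by (rule measurable_compose[OF measurable_graph_UNIV]) simp
  show ?thesis unfolding mixed_at_def tv_dist_def by measurable
qed

lemma measurable_t_mix_le: "{\<omega> \<in> space M. t_mix n (\<lambda>s. G s \<omega>) \<epsilon> \<le> enat T} \<in> events"
  unfolding t_mix_le_iff by measurable

text \<open>The walk up to time \<open>s\<close> uses \<open>G\<^sub>1, \<dots>, G\<^sub>s\<close>, so the union bound runs over the times from \<open>1\<close> to
  \<open>T + \<lfloor>\<surd>n\<rfloor>\<close>; past time \<open>T\<close> the geometric error only decreases.\<close>
lemma prob_t_mix_le:
  assumes pq: "0 \<le> p" "p \<le> 1" "0 \<le> q" "q \<le> 1"
    and start: "distr M (count_space UNIV) (G 0) = measure_pmf (erdos_renyi n r)"
    and r_def: "r = p / (p + q)" and r: "0 < r"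
    and n: "2 \<le> n" and \<delta>: "0 < \<delta>" "\<delta> \<le> 1 / 10000" and T: "1 \<le> T"
    and small: "real n * exp (- (real n * r) / 32) \<le> 1"
    and \<epsilon>: "(1 - 1 / 2000) ^ T * sqrt n + 2002 * \<delta> \<le> \<epsilon>"
  shows "\<P>(\<omega> in M. t_mix n (\<lambda>s. G s \<omega>) \<epsilon> \<le> enat T) \<ge> 1 - (real T + sqrt n) *
    (2 * real n * exp (- \<delta>\<^sup>2 * (real (n - 1) * r) / 4) + 2 * real n * exp (- (real n * r) / 32))"
proof -
  define K where "K = T + nat \<lfloor>sqrt n\<rfloor>"
  define \<beta> where "\<beta> = 2 * real n * exp (- \<delta>\<^sup>2 * (real (n - 1) * r) / 4) + 2 * real n * exp (- (real n * r) / 32)"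
  define bad where "bad = (\<lambda>s. {\<omega> \<in> space M. G s \<omega> \<in> {E. \<not> concentrated n r \<delta> E}})"
  have bad_sets: "bad s \<in> events" for s unfolding bad_def by (rule graph_event)
  have r1: "0 \<le> r" "r \<le> 1" unfolding r_def using bernoulli_stationary[OF pq] by auto
  have \<delta>1: "0 \<le> \<delta>" "\<delta> \<le> 1" using \<delta> by auto
  have bad_le: "prob (bad s) \<le> \<beta>" for s
    unfolding bad_def prob_graph_in[OF pq start[unfolded r_def]] \<beta>_def
    using prob_not_concentrated[OF n r1 \<delta>(1) \<delta>1(2) small] by (simp add: r_def)
  have \<beta>0: "0 \<le> \<beta>" by (simp add: \<beta>_def)
  have "prob (\<Union>s\<in>{1..K}. bad s) \<le> (\<Sum>s\<in>{1..K}. prob (bad s))"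
    by (rule measure_UNION_le) (use bad_sets in auto)
  also have "\<dots> \<le> (\<Sum>s\<in>{1..K}. \<beta>)" by (intro sum_mono bad_le)
  also have "\<dots> = real K * \<beta>" by simp
  also have "\<dots> \<le> (real T + sqrt n) * \<beta>"
    using \<beta>0 by (intro mult_right_mono) (auto simp: K_def)
  finally have union: "prob (\<Union>s\<in>{1..K}. bad s) \<le> (real T + sqrt n) * \<beta>" .
  have "space M - (\<Union>s\<in>{1..K}. bad s) \<subseteq> {\<omega> \<in> space M. t_mix n (\<lambda>s. G s \<omega>) \<epsilon> \<le> enat T}"
  proof
    fix \<omega> assume \<omega>: "\<omega> \<in> space M - (\<Union>s\<in>{1..K}. bad s)"
    have good: "concentrated n r \<delta> (G s \<omega>)" if "1 \<le> s" "s \<le> K" for s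
      using \<omega> that by (auto simp: bad_def)
    have "mixed_at n (\<lambda>s. G s \<omega>) \<epsilon> s" if s: "T \<le> s" "real s \<le> real T + sqrt n" for s
    proof (rule concentrated_imp_mixed_at[OF n r \<delta>1(1) \<delta>(2)])
      have "int s - int T \<le> \<lfloor>sqrt n\<rfloor>" using s by (simp add: le_floor_iff)
      then have sK: "s \<le> K" unfolding K_def by linarith
      show "concentrated n r \<delta> (G s' \<omega>)" if "1 \<le> s'" "s' \<le> s" for s'
        using good that sK by simp
      show "1 \<le> s" using s T by simp
      have "(1 - 1 / 2000 :: real) ^ s * sqrt n \<le> (1 - 1 / 2000) ^ T * sqrt n"
        using s by (intro mult_right_mono power_decreasing) auto
      then show "(1 - 1 / 2000) ^ s * sqrt n + 2002 * \<delta> \<le> \<epsilon>" using \<epsilon> by linarith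
    qed
    then show "\<omega> \<in> {\<omega> \<in> space M. t_mix n (\<lambda>s. G s \<omega>) \<epsilon> \<le> enat T}"
      using \<omega> by (auto simp: t_mix_le_iff)
  qed
  then have "prob (space M - (\<Union>s\<in>{1..K}. bad s)) \<le> \<P>(\<omega> in M. t_mix n (\<lambda>s. G s \<omega>) \<epsilon> \<le> enat T)"
    by (intro finite_measure_mono measurable_t_mix_le)
  moreover have "prob (space M - (\<Union>s\<in>{1..K}. bad s)) = 1 - prob (\<Union>s\<in>{1..K}. bad s)"
    by (intro prob_compl) (use bad_sets in auto)
  ultimately show ?thesis using union by (simp add: \<beta>_def)
qed

end

section \<open>Asymptotics\<close>

text \<open>The choice of \<open>\<delta>\<close> makes the Chernoff exponent for the degrees exactly \<open>4 log n\<close>.\<close>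
lemma failure_probability_le:
  assumes n: "3 \<le> n" and D: "0 < real (n - 1) * r"
    and nr: "128 * ln (real n) \<le> real n * r"
    and \<delta>: "\<delta> = sqrt (16 * ln (real n) / (real (n - 1) * r))"
  shows "real n * exp (- (real n * r) / 32) \<le> 1"
    and "2 * real n * exp (- \<delta>\<^sup>2 * (real (n - 1) * r) / 4) + 2 * real n * exp (- (real n * r) / 32)
      \<le> 4 / real n ^ 3"
proof -
  have n0: "0 < real n" using n by simp
  have powers: "exp (- (4 * ln (real n))) = 1 / real n ^ 4"
    using n0 by (simp add: exp_minus exp_of_nat_mult[of 4, simplified] divide_inverse)
  have "exp (- (real n * r) / 32) \<le> exp (- (4 * ln (real n)))" using nr by simp
  then have a: "exp (- (real n * r) / 32) \<le> 1 / real n ^ 4" by (simp only: powers)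
  have "0 \<le> ln (real n)" using n by simp
  then have "\<delta>\<^sup>2 = 16 * ln (real n) / (real (n - 1) * r)"
    unfolding \<delta> by (intro real_sqrt_pow2 divide_nonneg_pos D) simp
  then have "\<delta>\<^sup>2 * (real (n - 1) * r) = 16 * ln (real n)"
    using D by (metis less_irrefl nonzero_eq_divide_eq)
  then have "- \<delta>\<^sup>2 * (real (n - 1) * r) / 4 = - (4 * ln (real n))" by simp
  then have b: "exp (- \<delta>\<^sup>2 * (real (n - 1) * r) / 4) = 1 / real n ^ 4" by (simp only: powers)
  have c: "real n * (1 / real n ^ 4) = 1 / real n ^ 3"
    using n0 by (simp add: field_simps power_Suc[symmetric])
  have d: "real n * exp (- (real n * r) / 32) \<le> 1 / real n ^ 3"
    using mult_left_mono[OF a, of "real n"] by (simp only: c)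
  also have "\<dots> \<le> 1" using n by simp
  finally show "real n * exp (- (real n * r) / 32) \<le> 1" .
  show "2 * real n * exp (- \<delta>\<^sup>2 * (real (n - 1) * r) / 4) + 2 * real n * exp (- (real n * r) / 32)
      \<le> 4 / real n ^ 3"
    unfolding b using c d by (simp add: mult.assoc)
qed

text \<open>With contraction rate \<open>1 - 1 / 2000\<close>, this many steps shrink the initial distance by the factor
  \<open>1 / (n + 1)\<close>, more than the \<open>\<surd>n\<close> lost to Cauchy-Schwarz.\<close>
definition mixing_steps :: "nat \<Rightarrow> nat" where
  "mixing_steps n = nat \<lceil>2000 * ln (real n + 1)\<rceil>"

lemma mixing_steps_bounds:
  "2000 * ln (real n + 1) \<le> real (mixing_steps n)"
  "real (mixing_steps n) \<le> 2000 * ln (real n + 1) + 1"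
proof -
  have "0 \<le> 2000 * ln (real n + 1)" by simp
  then show "2000 * ln (real n + 1) \<le> real (mixing_steps n)"
    "real (mixing_steps n) \<le> 2000 * ln (real n + 1) + 1"
    unfolding mixing_steps_def by linarith+
qed

lemma mixing_steps_bigo: "(\<lambda>n. real (mixing_steps n)) \<in> O(\<lambda>n. ln (real n))"
proof (rule bigoI[where c = 4001])
  show "\<forall>\<^sub>F n in sequentially. norm (real (mixing_steps n)) \<le> 4001 * norm (ln (real n))"
  proof (rule eventually_sequentiallyI[of 3])
    fix n :: nat assume n: "3 \<le> n"
    have "exp 1 \<le> (3 :: real)" by (rule exp_le)
    then have "exp 1 \<le> real n" using n by linarith
    then have l1: "1 \<le> ln (real n)" using n by (simp add: ln_ge_iff)
    have "real n + 1 \<le> real n * real n"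
      using mult_right_mono[of 3 "real n" "real n"] n by linarith
    then have "ln (real n + 1) \<le> ln (real n * real n)" using n by simp
    also have "\<dots> = 2 * ln (real n)" using n by (simp add: ln_mult)
    finally show "norm (real (mixing_steps n)) \<le> 4001 * norm (ln (real n))"
      using mixing_steps_bounds(2)[of n] l1 by simp
  qed
qed

lemma power_mixing_steps_le:
  "(1 - 1 / 2000) ^ mixing_steps n * sqrt n \<le> 1 / sqrt (real n + 1)"
proof -
  have "(1 - 1 / 2000 :: real) ^ mixing_steps n \<le> exp (- 1 / 2000) ^ mixing_steps n"
    using exp_ge_add_one_self[of "- 1 / 2000 :: real"] by (intro power_mono) auto
  also have "\<dots> = exp (- (real (mixing_steps n) / 2000))"
    by (simp add: exp_of_nat_mult[symmetric])
  also have "\<dots> \<le> exp (- ln (real n + 1))"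
    using mixing_steps_bounds(1)[of n] by simp
  also have "\<dots> = 1 / (real n + 1)" by (simp add: exp_minus divide_inverse)
  finally have "(1 - 1 / 2000) ^ mixing_steps n * sqrt n \<le> 1 / (real n + 1) * sqrt (real n + 1)"
    by (intro mult_mono) auto
  also have "\<dots> = 1 / sqrt (real n + 1)"
    using real_sqrt_mult_self[of "real n + 1"] by (simp add: field_simps)
  finally show ?thesis .
qed

text \<open>Since \<open>p + q \<le> 2\<close>, the stationary edge probability is at least \<open>p / 2\<close>; replacing \<open>n\<close> by \<open>n - 1\<close>
  costs another factor \<open>2\<close>, whence the constant \<open>4\<close> below.\<close>
lemma mean_degree_superlogarithmic:
  fixes p q :: "nat \<Rightarrow> real"
  assumes p: "\<And>n. p n \<in> {0..1}" and q: "\<And>n. q n \<in> {0..1}"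
    and growth: "p \<in> \<omega>(\<lambda>n. ln (real n) / real n)" and c: "0 < c"
  shows "\<forall>\<^sub>F n in sequentially. 3 \<le> n \<and> 0 < p n / (p n + q n)
    \<and> c * ln (real n) \<le> real (n - 1) * (p n / (p n + q n))"
proof -
  have "\<forall>\<^sub>F n in sequentially. norm (p n) \<ge> 4 * c * norm (ln (real n) / real n)"
    using growth c by (intro landau_omega.smallD) auto
  then show ?thesis using eventually_ge_at_top[of 3]
  proof eventually_elim
    case (elim n)
    have pn: "4 * c * (ln (real n) / real n) \<le> p n" using elim p[of n] by simp
    have ln0: "0 < ln (real n)" using elim by simp
    have "0 < 4 * c * (ln (real n) / real n)" using c ln0 elim by simp
    then have p0: "0 < p n" using pn by linarith
    have half: "p n / 2 \<le> p n / (p n + q n)"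
      using p0 p[of n] q[of n] by (intro divide_left_mono) auto
    have "4 * c * ln (real n) \<le> real n * p n" using pn elim by (simp add: field_simps)
    also have "\<dots> \<le> (2 * real (n - 1)) * p n" using elim p0 by (intro mult_right_mono) auto
    finally have "c * ln (real n) \<le> real (n - 1) * (p n / 2)" by argo
    also have "\<dots> \<le> real (n - 1) * (p n / (p n + q n))" by (intro mult_left_mono half) simp
    finally have "c * ln (real n) \<le> real (n - 1) * (p n / (p n + q n))" .
    moreover have "0 < p n / (p n + q n)" using half p0 by linarith
    ultimately show ?case using elim by simp
  qed
qed

theorem theorem1p2:
  fixes p q :: "nat \<Rightarrow> real"
    and M :: "nat \<Rightarrow> 'w measure"
    and G :: "nat \<Rightarrow> nat \<Rightarrow> 'w \<Rightarrow> nat set set"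
  assumes p_range: "\<And>n. p n \<in> {0..1}"
    and q_range: "\<And>n. q n \<in> {0..1}"
    and p_growth: "p \<in> \<omega>(\<lambda>n. ln (real n) / real n)"
    and q_growth: "q \<in> \<Omega>(\<lambda>_. 1)"
    and process: "\<And>n. edge_markovian (M n) n (p n) (q n) (G n)"
    and start: "\<And>n. distr (M n) (count_space UNIV) (G n 0)
                  = measure_pmf (erdos_renyi n (p n / (p n + q n)))"
  shows "\<exists>(t :: nat \<Rightarrow> nat) (\<epsilon> :: nat \<Rightarrow> real) (\<delta> :: nat \<Rightarrow> real).
           (\<lambda>n. real (t n)) \<in> O(\<lambda>n. ln (real n)) \<and>
           (\<forall>n. \<epsilon> n > 0) \<and> \<epsilon> \<longlonglongrightarrow> 0 \<and> \<delta> \<longlonglongrightarrow> 0 \<and>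
           (\<forall>\<^sub>F n in sequentially.
              \<P>(\<omega> in M n. t_mix n (\<lambda>s. G n s \<omega>) (\<epsilon> n) \<le> enat (t n)) \<ge> 1 - \<delta> n)"
proof -
  define r where "r = (\<lambda>n. p n / (p n + q n))"
  define D where "D = (\<lambda>n. real (n - 1) * r n)"
  define d where "d = (\<lambda>n. sqrt (16 * ln (real n) / D n))"
  define \<epsilon> where "\<epsilon> = (\<lambda>n. 2002 * d n + 1 / sqrt (real n + 1))"
  \<comment> \<open>At most \<open>2002 n\<close> times, each failing with probability at most \<open>4 / n\<^sup>3\<close>.\<close>
  define \<delta> where "\<delta> = (\<lambda>n. 8008 / real n ^ 2)"
  have large: "\<forall>\<^sub>F n in sequentially. 3 \<le> n \<and> 0 < r n \<and> c * ln (real n) \<le> D n" if "0 < c" for c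
    using mean_degree_superlogarithmic[OF p_range q_range p_growth that] by (simp add: r_def D_def)
  have r0: "0 \<le> r n" for n using p_range[of n] q_range[of n] by (simp add: r_def)
  have d0: "0 \<le> d n" for n
  proof -
    have "0 \<le> ln (real n)" by (cases "n = 0") auto
    then show ?thesis using r0[of n] by (simp add: d_def D_def)
  qed
  have quot: "(\<lambda>n. ln (real n) / D n) \<longlonglongrightarrow> 0"
  proof (rule tendstoI)
    fix e :: real assume e: "0 < e"
    then have "0 < 2 / e" by simp
    from large[OF this] show "\<forall>\<^sub>F n in sequentially. dist (ln (real n) / D n) 0 < e"
    proof eventually_elim
      case (elim n)
      have ln0: "0 < ln (real n)" using elim by simp
      have "0 < 2 / e * ln (real n)" using e ln0 by simp
      then have D0: "0 < D n" using elim by linarith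
      have "2 * ln (real n) \<le> e * D n" using elim e by (simp add: field_simps)
      then have "ln (real n) < e * D n" using ln0 by linarith
      then show ?case using D0 ln0 by (simp add: divide_less_eq)
    qed
  qed
  have "d \<longlonglongrightarrow> sqrt (16 * 0)"
    unfolding d_def using tendsto_real_sqrt[OF tendsto_mult_left[OF quot, of 16]] by simp
  then have d_lim: "d \<longlonglongrightarrow> 0" by simp
  have sqrt_lim: "(\<lambda>n. 1 / sqrt (real n + 1)) \<longlonglongrightarrow> 0"
    using tendsto_real_sqrt[OF LIMSEQ_inverse_real_of_nat]
    by (simp add: real_sqrt_inverse inverse_eq_divide real_sqrt_divide add.commute)
  have "\<epsilon> \<longlonglongrightarrow> 2002 * 0 + 0"
    unfolding \<epsilon>_def by (intro tendsto_intros d_lim sqrt_lim)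
  then have eps_lim: "\<epsilon> \<longlonglongrightarrow> 0" by simp
  have eps_pos: "0 < \<epsilon> n" for n
    unfolding \<epsilon>_def using d0[of n] by (intro add_nonneg_pos) auto
  have delta_lim: "\<delta> \<longlonglongrightarrow> 0" 
    using tendsto_mult_left[OF tendsto_power[OF lim_1_over_n, of 2], of "8008 :: real"]
    by (simp add: \<delta>_def power_divide)
  have "\<forall>\<^sub>F n in sequentially. d n < 1 / 10000"
    using d_lim by (rule order_tendstoD) simp
  then have "\<forall>\<^sub>F n in sequentially.
      \<P>(\<omega> in M n. t_mix n (\<lambda>s. G n s \<omega>) (\<epsilon> n) \<le> enat (mixing_steps n)) \<ge> 1 - \<delta> n"
    \<comment> \<open>The threshold \<open>128\<close> turns \<open>exp(- n r / 32)\<close> into at most \<open>n\<^sup>-\<^sup>4\<close>.\<close>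
    using large[of 128, simplified]
  proof eventually_elim
    case (elim n)
    interpret edge_markovian "M n" n "p n" "q n" "G n" by (rule process)
    have ln0: "0 < ln (real n)" using elim by simp
    then have D0: "0 < D n" using elim by linarith
    have d_pos: "0 < d n" using ln0 D0 by (simp add: d_def)
    have "D n \<le> real n * r n" unfolding D_def using r0[of n] by (intro mult_right_mono) auto
    then have nr: "128 * ln (real n) \<le> real n * r n" using elim by linarith
    note err = failure_probability_le[OF _ D0[unfolded D_def] nr d_def[unfolded D_def, THEN fun_cong]]
    have "0 < 2000 * ln (real n + 1)" using elim by simp
    then have T: "1 \<le> mixing_steps n" using mixing_steps_bounds(1)[of n] by linarith
    define b where "b = 2 * real n * exp (- (d n)\<^sup>2 * (real (n - 1) * r n) / 4)
        + 2 * real n * exp (- (real n * r n) / 32)"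
    have "(1 - 1 / 2000) ^ mixing_steps n * sqrt n + 2002 * d n \<le> \<epsilon> n"
      using power_mixing_steps_le[of n] by (simp add: \<epsilon>_def)
    then have main: "1 - (real (mixing_steps n) + sqrt n) * b
      \<le> \<P>(\<omega> in M n. t_mix n (\<lambda>s. G n s \<omega>) (\<epsilon> n) \<le> enat (mixing_steps n))"
      unfolding b_def using p_range[of n] q_range[of n] elim start[of n] d_pos T err(1)
      by (intro prob_t_mix_le) (auto simp: r_def)
    have "sqrt n \<le> real n"
      using elim real_sqrt_le_mono[of "real n" "(real n)\<^sup>2"] by (simp add: power2_eq_square)
    moreover have "real (mixing_steps n) \<le> 2001 * real n"
      using mixing_steps_bounds(2)[of n] ln_add_one_self_le_self[of "real n"] elim
      by (simp add: add.commute)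
    ultimately have "(real (mixing_steps n) + sqrt n) * b \<le> (2002 * real n) * (4 / real n ^ 3)"
      using err(2) elim by (intro mult_mono) (auto simp: b_def)
    also have "\<dots> = \<delta> n" using elim by (simp add: \<delta>_def power2_eq_square power3_eq_cube)
    finally show ?case using main by linarith
  qed
  then show ?thesis
    using mixing_steps_bigo eps_pos eps_lim delta_lim by blast
qed

end
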